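(* Among all $3$-regular $3$-edge-colored graphs $G$ on $2n=16$ vertices (so $n=8$) such that $G$ has exactly two faces for each pair of colors, all faces of $G$ have length eight, and every two faces of $G$ having exactly one color in common share exactly two edges, there exists, up to isomorphism, a single graph with $\max_M F(M,G)=\frac{3n}{2}=12$, the maximum being over all pairings $M$ of the vertex set of $G$. This graph is the graph $G_{\mathrm{ex}}$ given in the context.
   Context: A pairing of a finite set $V$ of even cardinality is a partition of $V$ into unordered pairs. A $3$-regular $3$-edge-colored graph on $2n$ vertices is a tuple $G=(V,E_1,E_2,E_3)$ with $|V|=2n$ and each $E_i$ a pairing of $V$, called the set of edges of color $i$ (edges of different colors may join the same two vertices and are regarded as different edges). Two such graphs are isomorphic if there is a bijection of their vertex sets mapping edges of color $i$ to edges of color $i$ for each $i\in\{1,2,3\}$. Faces: for $i\ne j$, a face of colors $(i,j)$ is a connected component of $(V,E_i,E_j)$, i.e. a cycle whose edges alternate between colors $i$ and $j$. Its length is its number of edges. For a pairing $M$ of $V$, viewed as edges of a new color $0$, $F(M,G)=\sum_{i=1}^{3}F_{0i}(G\cup M)$, where $F_{0i}(G\cup M)$ is the number of connected components of $(V,M,E_i)$, i.e. the number of cycles alternating between edges of $M$ and edges of color $i$. The graph $G_{\mathrm{ex}}$ has vertex set $\{1,\dots,16\}$ and $E_1=\{\{1,2\},\{3,4\},\{5,6\},\{7,8\},\{9,10\},\{11,12\},\{13,14\},\{15,16\}\}$, $E_2=\{\{2,3\},\{4,5\},\{6,7\},\{8,1\},\{10,11\},\{12,13\},\{14,15\},\{16,9\}\}$,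 $E_3=\{\{1,3\},\{2,9\},\{4,11\},\{5,7\},\{6,13\},\{8,15\},\{10,12\},\{14,16\}\}$. *)

theory Defs
  imports "HOL-Library.Disjoint_Sets"
begin

definition pairing :: "'a set \<Rightarrow> 'a set set \<Rightarrow> bool" where
  "pairing V M \<longleftrightarrow> partition_on V M \<and> (\<forall>e\<in>M. card e = 2)"

text \<open>
  The edge set of color \<open>i\<close> is \<open>edges G i\<close>. Graphs themselves use the colors 1, 2, 3;
  the values of \<open>edges G\<close> elsewhere carry no meaning, except that color 0 is used when
  a pairing is added by \<open>add_pairing\<close> below.
\<close>

record 'a colored_graph =
  verts :: "'a set"
  edges :: "nat \<Rightarrow> 'a set set"

definition regular_3_edge_colored :: "nat \<Rightarrow> 'a colored_graph \<Rightarrow> bool" where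
  "regular_3_edge_colored n G \<longleftrightarrow>
     finite (verts G) \<and> card (verts G) = 2 * n \<and> (\<forall>i\<in>{1,2,3}. pairing (verts G) (edges G i))"

definition isomorphic :: "'a colored_graph \<Rightarrow> 'b colored_graph \<Rightarrow> bool" where
  "isomorphic G H \<longleftrightarrow>
     (\<exists>f. bij_betw f (verts G) (verts H) \<and>
          (\<forall>i\<in>{1,2,3}. (\<lambda>e. f ` e) ` edges G i = edges H i))"

definition adjacency :: "'a colored_graph \<Rightarrow> nat \<Rightarrow> nat \<Rightarrow> 'a rel" where
  "adjacency G i j = {(x, y). {x, y} \<in> edges G i \<union> edges G j}"

text \<open>
  A face of colors \<open>i, j\<close> is represented by the vertex set of a connected component of
  \<open>(V, E\<^sub>i, E\<^sub>j)\<close>. Its edges are tagged with their color, so that edges of different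
  colors joining the same two vertices remain different.
\<close>

definition faces :: "'a colored_graph \<Rightarrow> nat \<Rightarrow> nat \<Rightarrow> 'a set set" where
  "faces G i j = verts G // (adjacency G i j)\<^sup>*"

definition face_edges :: "'a colored_graph \<Rightarrow> nat \<Rightarrow> nat \<Rightarrow> 'a set \<Rightarrow> (nat \<times> 'a set) set" where
  "face_edges G i j C = {(c, e). c \<in> {i, j} \<and> e \<in> edges G c \<and> e \<subseteq> C}"

definition face_length :: "'a colored_graph \<Rightarrow> nat \<Rightarrow> nat \<Rightarrow> 'a set \<Rightarrow> nat" where
  "face_length G i j C = card (face_edges G i j C)"

definition two_faces_per_color_pair :: "'a colored_graph \<Rightarrow> bool" where
  "two_faces_per_color_pair G \<longleftrightarrow>
     (\<forall>i\<in>{1,2,3}. \<forall>j\<in>{1,2,3}. i \<noteq> j \<longrightarrow> card (faces G i j) = 2)"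

definition all_faces_length_8 :: "'a colored_graph \<Rightarrow> bool" where
  "all_faces_length_8 G \<longleftrightarrow>
     (\<forall>i\<in>{1,2,3}. \<forall>j\<in>{1,2,3}. i \<noteq> j \<longrightarrow> (\<forall>C\<in>faces G i j. face_length G i j C = 8))"

definition faces_share_two_edges :: "'a colored_graph \<Rightarrow> bool" where
  "faces_share_two_edges G \<longleftrightarrow>
     (\<forall>i\<in>{1,2,3}. \<forall>j\<in>{1,2,3}. \<forall>k\<in>{1,2,3}. \<forall>l\<in>{1,2,3}.
        i \<noteq> j \<longrightarrow> k \<noteq> l \<longrightarrow> card ({i, j} \<inter> {k, l}) = 1 \<longrightarrow>
        (\<forall>C\<in>faces G i j. \<forall>D\<in>faces G k l.
           card (face_edges G i j C \<inter> face_edges G k l D) = 2))"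

definition add_pairing :: "'a colored_graph \<Rightarrow> 'a set set \<Rightarrow> 'a colored_graph" where
  "add_pairing G M = G\<lparr>edges := (edges G)(0 := M)\<rparr>"

definition F_sum :: "'a set set \<Rightarrow> 'a colored_graph \<Rightarrow> nat" where
  "F_sum M G = (\<Sum>i\<in>{1,2,3}. card (faces (add_pairing G M) 0 i))"

definition F_max :: "'a colored_graph \<Rightarrow> nat" where
  "F_max G = Max {F_sum M G | M. pairing (verts G) M}"

definition G_ex :: "nat colored_graph" where
  "G_ex = \<lparr>verts = {1..16},
     edges = (\<lambda>_. {})
      (1 := {{1,2},{3,4},{5,6},{7,8},{9,10},{11,12},{13,14},{15,16}},
       2 := {{2,3},{4,5},{6,7},{8,1},{10,11},{12,13},{14,15},{16,9}},
       3 := {{1,3},{2,9},{4,11},{5,7},{6,13},{8,15},{10,12},{14,16}})\<rparr>"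

end

theory Submission
  imports Defs
begin

text \<open>
  Let \<open>u v\<close> be an edge of the added pairing \<open>M\<close>. Deleting \<open>u\<close> and \<open>v\<close> and joining, in each color,
  their two neighbors lowers the number of \<open>(0, i)\<close>-cycles by one if \<open>u v\<close> is also an edge of
  color \<open>i\<close>, and leaves it unchanged otherwise. This evaluates \<open>F(M, G)\<close>. It also bounds it: a
  cycle that is not a doubled edge has at least four vertices, so
  \<open>4 F(M, G) \<le> 3 |V| + \<Sum>\<^sub>x #{i. M and E\<^sub>i agree at x}\<close>, and as long as this does not suffice, one
  branches on whether a chosen edge of \<open>G\<close> belongs to \<open>M\<close>, contracting or forbidding it.
  About a thousand contractions show \<open>F(M, G_ex) \<le> 12\<close> for all \<open>M\<close>.

  For uniqueness, some edge of color 3 joins the two faces of colors 1, 2, as otherwise a face of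
  colors 1, 3 would lie inside one of them. So the vertices can be labelled such that colors 1, 2
  are those of \<open>G_ex\<close> and \<open>{2, 9}\<close> has color 3. A backtracking search along the faces then finds
  all possible colors 3; each of them either admits one of fifteen pairings with at least 13 cycles or
  is one of two tables isomorphic to that of \<open>G_ex\<close>.
\<close>

section \<open>Components of two involutions\<close>

text \<open>A pairing of \<open>V\<close>, given by the map to partners. Values outside
  \<open>V\<close> are free, so that the same \<open>m\<close> still serves after vertices are
  deleted from \<open>V\<close>.\<close>

definition invol_on :: "'a set \<Rightarrow> ('a \<Rightarrow> 'a) \<Rightarrow> bool" where
  "invol_on V p \<longleftrightarrow> (\<forall>x\<in>V. p x \<in> V \<and> p x \<noteq> x \<and> p (p x) = x)"

lemma invol_onD:
  assumes "invol_on V p" "x \<in> V"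
  shows "p x \<in> V" "p x \<noteq> x" "p (p x) = x"
  using assms by (auto simp: invol_on_def)

definition link :: "'a set \<Rightarrow> ('a \<Rightarrow> 'a) \<Rightarrow> ('a \<Rightarrow> 'a) \<Rightarrow> 'a rel" where
  "link V p q = {(x, y). x \<in> V \<and> (y = p x \<or> y = q x)}"

definition num_components :: "'a set \<Rightarrow> ('a \<Rightarrow> 'a) \<Rightarrow> ('a \<Rightarrow> 'a) \<Rightarrow> nat" where
  "num_components V p q = card (V // (link V p q)\<^sup>*)"

lemma sym_link: "invol_on V p \<Longrightarrow> invol_on V q \<Longrightarrow> sym (link V p q)"
  by (auto simp: sym_def link_def invol_on_def)

lemma rtrancl_Image_eq:
  assumes "sym R"
  shows "R\<^sup>* `` {x} = R\<^sup>* `` {y} \<longleftrightarrow> (x, y) \<in> R\<^sup>*"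
proof -
  have s: "(b, a) \<in> R\<^sup>*" if "(a, b) \<in> R\<^sup>*" for a b
    using sym_rtrancl[OF assms] that by (rule symD)
  show ?thesis
  proof
    assume "R\<^sup>* `` {x} = R\<^sup>* `` {y}"
    moreover have "y \<in> R\<^sup>* `` {y}" by simp
    ultimately show "(x, y) \<in> R\<^sup>*" by blast
  next
    assume xy: "(x, y) \<in> R\<^sup>*"
    show "R\<^sup>* `` {x} = R\<^sup>* `` {y}"
      using rtrancl_trans[OF xy] rtrancl_trans[OF s[OF xy]] by blast
  qed
qed

text \<open>Both images index the classes of the same kernel, so choosing a preimage under
  \<open>f\<close> and applying \<open>g\<close> to it is a bijection between them.\<close>

lemma card_image_cong_ker:
  assumes "\<And>x y. x \<in> A \<Longrightarrow> y \<in> A \<Longrightarrow> f x = f y \<longleftrightarrow> g x = g y"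
  shows "card (f ` A) = card (g ` A)"
proof -
  let ?h = "\<lambda>z. g (SOME x. x \<in> A \<and> f x = z)"
  have h: "?h (f x) = g x" if "x \<in> A" for x
  proof -
    have "(SOME y. y \<in> A \<and> f y = f x) \<in> A \<and> f (SOME y. y \<in> A \<and> f y = f x) = f x"
      by (rule someI[where x = x]) (use that in auto)
    then show ?thesis using assms that by blast
  qed
  have "inj_on ?h (f ` A)"
  proof (rule inj_onI)
    fix y z assume "y \<in> f ` A" "z \<in> f ` A" and eq: "?h y = ?h z"
    then obtain a b where ab: "y = f a" "z = f b" "a \<in> A" "b \<in> A" by blast
    have "g a = g b" using eq unfolding ab(1,2) h[OF ab(3)] h[OF ab(4)] .
    then show "y = z" using ab assms by simp
  qed
  moreover have "?h ` f ` A = g ` A"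
    unfolding image_image using h by (rule image_cong[OF refl])
  ultimately show ?thesis by (metis card_image)
qed

text \<open>A map that preserves and reflects the equivalence and reaches every class induces a
  bijection of the quotients. It is applied to the inclusion of a vertex set with two vertices
  deleted.\<close>

lemma card_quotient_transfer:
  assumes R: "sym R" and S: "sym S"
    and h: "\<And>a. a \<in> A \<Longrightarrow> h a \<in> B"
    and surj: "\<And>b. b \<in> B \<Longrightarrow> \<exists>a\<in>A. (h a, b) \<in> S\<^sup>*"
    and iff: "\<And>a a'. a \<in> A \<Longrightarrow> a' \<in> A \<Longrightarrow> (a, a') \<in> R\<^sup>* \<longleftrightarrow> (h a, h a') \<in> S\<^sup>*"
  shows "card (A // R\<^sup>*) = card (B // S\<^sup>*)"
proof -
  have "B // S\<^sup>* = (\<lambda>a. S\<^sup>* `` {h a}) ` A"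
  proof (intro set_eqI iffI)
    fix C assume "C \<in> B // S\<^sup>*"
    then obtain b where b: "b \<in> B" "C = S\<^sup>* `` {b}" by (auto simp: quotient_def)
    with surj obtain a where "a \<in> A" "(h a, b) \<in> S\<^sup>*" by blast
    then show "C \<in> (\<lambda>a. S\<^sup>* `` {h a}) ` A" using b rtrancl_Image_eq[OF S] by blast
  qed (use h in \<open>auto simp: quotient_def\<close>)
  moreover have "A // R\<^sup>* = (\<lambda>a. R\<^sup>* `` {a}) ` A"
    by (auto simp: quotient_def)
  moreover have "card ((\<lambda>a. R\<^sup>* `` {a}) ` A) = card ((\<lambda>a. S\<^sup>* `` {h a}) ` A)"
    by (rule card_image_cong_ker) (simp add: rtrancl_Image_eq[OF R] rtrancl_Image_eq[OF S] iff)
  ultimately show ?thesis by simp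
qed

lemma rtrancl_map:
  assumes "(x, y) \<in> R\<^sup>*" and "\<And>x y. (x, y) \<in> R \<Longrightarrow> (f x, f y) \<in> S\<^sup>*"
  shows "(f x, f y) \<in> S\<^sup>*"
  using assms(1) by (induction rule: rtrancl_induct) (auto intro: rtrancl_trans assms(2))

section \<open>Contracting an edge of the pairing\<close>

definition reroute :: "'v \<Rightarrow> 'v \<Rightarrow> 'v \<Rightarrow> 'v \<Rightarrow> 'v \<Rightarrow> 'v" where
  "reroute u v pu pv y = (if y = u then pv else if y = v then pu else y)"

text \<open>The neighbors of \<open>u\<close> and of \<open>v\<close> become neighbors of each
  other. \<open>reroute\<close> works on the value \<open>p x\<close> alone, so that it also applies
  to the entries of a node list.\<close>

definition bypass :: "'v \<Rightarrow> 'v \<Rightarrow> ('v \<Rightarrow> 'v) \<Rightarrow> 'v \<Rightarrow> 'v" where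
  "bypass u v p x = reroute u v (p u) (p v) (p x)"

lemma invol_on_bypass:
  assumes "invol_on V p" "u \<in> V" "v \<in> V" "u \<noteq> v"
  shows "invol_on (V - {u, v}) (bypass u v p)"
  unfolding invol_on_def
proof (intro ballI)
  note P = invol_onD[OF assms(1)]
  fix x assume x: "x \<in> V - {u, v}"
  show "bypass u v p x \<in> V - {u, v} \<and> bypass u v p x \<noteq> x \<and> bypass u v p (bypass u v p x) = x"
    using x P[of x] P[of u] P[of v] assms(2-4)
    by (cases "p x = u"; cases "p x = v") (auto simp: bypass_def reroute_def)
qed

lemma invol_on_remove:
  assumes "invol_on V m" "u \<in> V" "m u = v"
  shows "invol_on (V - {u, v}) m"
  using assms unfolding invol_on_def by (metis DiffE DiffI insert_iff singletonD insertCI)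

text \<open>If \<open>p u = v\<close>, the doubled edge is a component of its own and disappears.
  Otherwise the stretch \<open>p u\<close>, \<open>u\<close>, \<open>v\<close>, \<open>p v\<close>
  of its cycle is shortened to a single edge, and the cycle survives because \<open>p u\<close>
  does.\<close>

lemma num_components_contract:
  assumes V: "finite V" and m: "invol_on V m" and p: "invol_on V p" and u: "u \<in> V" and v: "m u = v"
  shows "num_components V m p = (if p u = v then 1 else 0) + num_components (V - {u, v}) m (bypass u v p)"
proof -
  let ?W = "V - {u, v}" and ?R = "link V m p" and ?S = "link (V - {u, v}) m (bypass u v p)"
  have vV: "v \<in> V" and uv: "u \<noteq> v" and mv: "m v = u"
    using invol_onD[OF m u] v by auto
  have symR: "sym ?R" using sym_link[OF m p] .
  have symS: "sym ?S"
    by (intro sym_link invol_on_bypass invol_on_remove m p u vV uv v)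
  have mW: "m x \<in> ?W" if "x \<in> ?W" for x
    using that invol_onD[OF invol_on_remove[OF m u v]] by blast
  show ?thesis
  proof (cases "p u = v")
    case True
    have pv: "p v = u" using invol_onD[OF p u] True by auto
    have pW: "p x \<in> ?W" if "x \<in> ?W" for x
      using that True pv invol_onD[OF p] by (metis Diff_iff insert_iff singletonD)
    have byp: "bypass u v p x = p x" if "x \<in> ?W" for x
      using pW[OF that] by (auto simp: bypass_def reroute_def)
    have 1: "?R\<^sup>* `` {x} = ?S\<^sup>* `` {x}" if "x \<in> ?W" for x
    proof -
      have "(x, y) \<in> ?R\<^sup>* \<Longrightarrow> (x, y) \<in> ?S\<^sup>* \<and> y \<in> ?W" for y
      proof (induction rule: rtrancl_induct)
        case base then show ?case using that by simp
      next
        case (step y z)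
        then have "(y, z) \<in> ?S" "z \<in> ?W" using byp mW pW by (auto simp: link_def)
        then show ?case using step by (meson rtrancl.rtrancl_into_rtrancl)
      qed
      moreover have "?S \<subseteq> ?R" using byp by (auto simp: link_def)
      then have "?S\<^sup>* \<subseteq> ?R\<^sup>*" by (rule rtrancl_mono)
      ultimately show ?thesis by blast
    qed
    have 2: "?R\<^sup>* `` {x} = {u, v}" if "x \<in> {u, v}" for x
    proof
      show "?R\<^sup>* `` {x} \<subseteq> {u, v}"
      proof
        fix y assume "y \<in> ?R\<^sup>* `` {x}"
        then have "(x, y) \<in> ?R\<^sup>*" by simp
        then show "y \<in> {u, v}"
          by (induction rule: rtrancl_induct) (use that True pv v mv in \<open>auto simp: link_def\<close>)
      qed
      have "(u, v) \<in> ?R" "(v, u) \<in> ?R" using u vV v mv by (auto simp: link_def)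
      then show "{u, v} \<subseteq> ?R\<^sup>* `` {x}" using that by auto
    qed
    have "V = {u, v} \<union> ?W" using u vV by blast
    then have "V // ?R\<^sup>* = (\<lambda>x. ?R\<^sup>* `` {x}) ` {u, v} \<union> (\<lambda>x. ?R\<^sup>* `` {x}) ` ?W"
      unfolding quotient_def by blast
    also have "(\<lambda>x. ?R\<^sup>* `` {x}) ` {u, v} = {{u, v}}" using 2 by auto
    also have "(\<lambda>x. ?R\<^sup>* `` {x}) ` ?W = ?W // ?S\<^sup>*" unfolding quotient_def using 1 by auto
    finally have q: "V // ?R\<^sup>* = insert {u, v} (?W // ?S\<^sup>*)" by simp
    have "{u, v} \<notin> ?W // ?S\<^sup>*" by (auto simp: quotient_def)
    moreover have "finite (?W // ?S\<^sup>*)" using V by (simp add: quotient_def)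
    ultimately show ?thesis using True q by (simp add: num_components_def)
  next
    case False
    define s t where "s = p u" and "t = p v"
    have st: "s \<in> ?W" "t \<in> ?W" "s \<noteq> t" "p s = u" "p t = v"
      using False invol_onD[OF p u] invol_onD[OF p vV] uv by (auto simp: s_def t_def)
    have bs: "bypass u v p s = t" "bypass u v p t = s"
      using st uv by (auto simp: bypass_def reroute_def s_def t_def)
    have bo: "bypass u v p x = p x" "p x \<in> ?W" if "x \<in> ?W" "x \<noteq> s" "x \<noteq> t" for x
    proof -
      have "p x \<noteq> u" "p x \<noteq> v" using that invol_onD[OF p] by (auto simp: s_def t_def)
      then show "bypass u v p x = p x" "p x \<in> ?W" using that invol_onD[OF p, of x]
        by (auto simp: bypass_def reroute_def)
    qed
    \<comment> \<open>A retraction onto the remaining vertices: each deleted vertex moves along its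
      own \<open>p\<close>-edge. It turns steps into paths of the contracted graph, while
      \<open>SR\<close> below expands the new edge between \<open>s\<close> and \<open>t\<close>
      back into a path.\<close>
    define \<rho> where "\<rho> x = (if x = u then s else if x = v then t else x)" for x
    have \<rho>: "(\<rho> x, \<rho> y) \<in> ?S\<^sup>*" if "(x, y) \<in> ?R" for x y
    proof -
      have S: "(s, t) \<in> ?S" "(t, s) \<in> ?S" using bs st by (auto simp: link_def)
      have xV: "x \<in> V" and y: "y = m x \<or> y = p x" using that by (auto simp: link_def)
      consider "x = u" | "x = v" | "x = s" "y = p x" | "x = t" "y = p x" | "x \<in> ?W" "y = m x"
        | "x \<in> ?W" "x \<noteq> s" "x \<noteq> t" "y = p x"
        using xV y by blast
      then show ?thesis
      proof cases
        case 5
        then have "(x, y) \<in> ?S" "y \<in> ?W" using mW by (auto simp: link_def)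
        then show ?thesis using 5 by (auto simp: \<rho>_def)
      next
        case 6
        then have "(x, y) \<in> ?S" "y \<in> ?W" using bo by (auto simp: link_def)
        then show ?thesis using 6 by (auto simp: \<rho>_def)
      qed (use S st uv y v mv in \<open>auto simp: \<rho>_def s_def[symmetric] t_def[symmetric]\<close>)
    qed
    have su: "(u, s) \<in> ?R" "(u, v) \<in> ?R" "(v, t) \<in> ?R" "(s, u) \<in> ?R" "(t, v) \<in> ?R" "(v, u) \<in> ?R"
      using u vV v mv st by (auto simp: link_def s_def t_def)
    have SR: "(x, y) \<in> ?R\<^sup>*" if "(x, y) \<in> ?S" for x y
    proof -
      have x: "x \<in> ?W" and y: "y = m x \<or> y = bypass u v p x" using that by (auto simp: link_def)
      consider "y = m x" | "x = s" "y = t" | "x = t" "y = s" | "y = p x"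
        using y bs bo x by blast
      then show ?thesis
      proof cases
        case 2
        then show ?thesis using su by (meson rtrancl.rtrancl_into_rtrancl r_into_rtrancl)
      next
        case 3
        then show ?thesis using su by (meson rtrancl.rtrancl_into_rtrancl r_into_rtrancl)
      qed (use x in \<open>auto simp: link_def\<close>)
    qed
    have "card (?W // ?S\<^sup>*) = card (V // ?R\<^sup>*)"
    proof (rule card_quotient_transfer[where h = id])
      show "\<exists>a\<in>?W. (id a, b) \<in> ?R\<^sup>*" if "b \<in> V" for b
      proof -
        consider "b \<in> ?W" | "b = u" | "b = v" using \<open>b \<in> V\<close> by blast
        then show ?thesis
          by cases (use su st in auto)
      qed
      show "(a, a') \<in> ?S\<^sup>* \<longleftrightarrow> (id a, id a') \<in> ?R\<^sup>*" if "a \<in> ?W" "a' \<in> ?W" for a a'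
      proof
        assume "(a, a') \<in> ?S\<^sup>*"
        then show "(id a, id a') \<in> ?R\<^sup>*" using rtrancl_map[of a a' ?S id ?R] SR by simp
      next
        assume "(id a, id a') \<in> ?R\<^sup>*"
        then have "(\<rho> a, \<rho> a') \<in> ?S\<^sup>*" using rtrancl_map[of a a' ?R \<rho> ?S] \<rho> by simp
        then show "(a, a') \<in> ?S\<^sup>*" using that by (simp add: \<rho>_def)
      qed
    qed (use symR symS in auto)
    then show ?thesis using False by (simp add: num_components_def)
  qed
qed

section \<open>Bounding the number of components by counting vertices\<close>

lemma rtrancl_link_closed:
  assumes "invol_on V p" "invol_on V q" "(x, y) \<in> (link V p q)\<^sup>*" "x \<in> V"
  shows "y \<in> V"
  using assms(3,4) by (induction rule: rtrancl_induct) (use assms in \<open>auto simp: link_def invol_on_def\<close>)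

lemma card_eq_sum_classes:
  assumes V: "finite V" and p: "invol_on V p" and q: "invol_on V q" and A: "A \<subseteq> V"
  shows "card A = (\<Sum>C\<in>V // (link V p q)\<^sup>*. card (A \<inter> C))"
proof -
  let ?E = "(link V p q)\<^sup>*"
  have sub: "C \<subseteq> V" if "C \<in> V // ?E" for C
    using that rtrancl_link_closed[OF p q] by (auto simp: quotient_def)
  have "A = (\<Union>C\<in>V // ?E. A \<inter> C)" using A by (auto simp: quotient_def)
  also have "card \<dots> = (\<Sum>C\<in>V // ?E. card (A \<inter> C))"
  proof (rule card_UN_disjoint)
    show "finite (V // ?E)" using V by (simp add: quotient_def)
    show "\<forall>C\<in>V // ?E. finite (A \<inter> C)" using V A by (auto intro: finite_subset)
    show "\<forall>C\<in>V // ?E. \<forall>D\<in>V // ?E. C \<noteq> D \<longrightarrow> A \<inter> C \<inter> (A \<inter> D) = {}"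
    proof (intro ballI impI)
      fix C D assume "C \<in> V // ?E" "D \<in> V // ?E" and CD: "C \<noteq> D"
      then obtain x y where xy: "C = ?E `` {x}" "D = ?E `` {y}" by (auto simp: quotient_def)
      have "C = ?E `` {z}" if "z \<in> C" for z
        using that rtrancl_Image_eq[OF sym_link[OF p q]] xy by simp
      moreover have "D = ?E `` {z}" if "z \<in> D" for z
        using that rtrancl_Image_eq[OF sym_link[OF p q]] xy by simp
      ultimately show "A \<inter> C \<inter> (A \<inter> D) = {}" using CD by blast
    qed
  qed
  finally show ?thesis .
qed

text \<open>Every component accounts for at least 4 on the right: a doubled edge has two vertices,
  each counted in both terms, and any other component contains the four distinct vertices
  \<open>x\<close>, \<open>m x\<close>, \<open>p x\<close>, \<open>m (p x)\<close>.\<close>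

lemma num_components_bound:
  assumes V: "finite V" and m: "invol_on V m" and p: "invol_on V p"
  shows "4 * num_components V m p \<le> card V + card {x \<in> V. p x = m x}"
proof -
  let ?E = "(link V m p)\<^sup>*" and ?D = "{x \<in> V. p x = m x}"
  have 4: "4 \<le> card (V \<inter> C) + card (?D \<inter> C)" if "C \<in> V // ?E" for C
  proof -
    obtain x where x: "x \<in> V" and C: "C = ?E `` {x}" using \<open>C \<in> V // ?E\<close> by (auto simp: quotient_def)
    have CV: "C \<subseteq> V" using C x rtrancl_link_closed[OF m p] by auto
    have step: "m y \<in> C \<and> p y \<in> C" if "y \<in> C" for y
      using that C CV by (auto simp: link_def intro: rtrancl.rtrancl_into_rtrancl)
    have xC: "x \<in> C" using C by simp
    have fin: "finite C" using CV V by (rule finite_subset)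
    note mx = invol_onD[OF m x] and px = invol_onD[OF p x]
    show ?thesis
    proof (cases "p x = m x")
      case True
      then have "p (m x) = m (m x)" using mx px by auto
      then have "{x, m x} \<subseteq> ?D \<inter> C" "{x, m x} \<subseteq> V \<inter> C" using True xC step x mx by auto
      then have "card {x, m x} \<le> card (?D \<inter> C)" "card {x, m x} \<le> card (V \<inter> C)"
        by (auto intro!: card_mono simp: fin)
      moreover have "card {x, m x} = 2" using mx by auto
      ultimately show ?thesis by linarith
    next
      case False
      have "m (p x) \<noteq> p x" "m (p x) \<noteq> m x" "m (p x) \<noteq> x"
        using False mx px invol_onD[OF m, of "p x"] by metis+
      then have "card {x, m x, p x, m (p x)} = 4" using False mx px by auto
      moreover have "{x, m x, p x, m (p x)} \<subseteq> V \<inter> C" using step xC CV by blast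
      then have "card {x, m x, p x, m (p x)} \<le> card (V \<inter> C)" by (auto intro!: card_mono simp: fin)
      ultimately show ?thesis by linarith
    qed
  qed
  have "4 * num_components V m p = (\<Sum>C\<in>V // ?E. 4)" by (simp add: num_components_def)
  also have "\<dots> \<le> (\<Sum>C\<in>V // ?E. card (V \<inter> C) + card (?D \<inter> C))"
    by (rule sum_mono) (use 4 in auto)
  also have "\<dots> = card V + card ?D"
    using card_eq_sum_classes[OF V m p, of V] card_eq_sum_classes[OF V m p, of ?D]
    by (simp add: sum.distrib)
  finally show ?thesis .
qed

section \<open>Contracting edges of the added pairing\<close>

text \<open>
  A node is a vertex with its neighbors in the three colors and the vertices that are excluded as
  its partner in \<open>M\<close>.
\<close>

datatype 'v node = Node (key: 'v) 'v 'v 'v "'v list"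

definition multiplicity :: "'v \<Rightarrow> 'v \<Rightarrow> 'v \<Rightarrow> 'v \<Rightarrow> nat" where
  "multiplicity v a b c = (if a = v then 1 else 0) + (if b = v then 1 else 0) + (if c = v then 1 else 0)"

text \<open>
  Nested conditionals are used in place of Boolean connectives here and below, because rewriting
  with the code equations evaluates both arguments of a connective, but only one branch of a
  conditional.
\<close>

fun mem :: "'v \<Rightarrow> 'v list \<Rightarrow> bool" where
  "mem x [] = False"
| "mem x (y # ys) = (if x = y then True else mem x ys)"

fun neighbors :: "'v node list \<Rightarrow> 'v \<Rightarrow> ('v \<times> 'v \<times> 'v) option" where
  "neighbors [] u = None"
| "neighbors (Node x a b c fb # st) u = (if x = u then Some (a, b, c) else neighbors st u)"

text \<open>The triples are the neighbors of \<open>u\<close> and \<open>v\<close>, whose own nodes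
  vanish on the way. The exclusion lists stay valid, as they concern partners in the pairing, which
  contraction does not change.\<close>

fun contract :: "'v \<Rightarrow> 'v \<Rightarrow> 'v \<times> 'v \<times> 'v \<Rightarrow> 'v \<times> 'v \<times> 'v \<Rightarrow> 'v node list \<Rightarrow> 'v node list" where
  "contract u v (a, b, c) (a', b', c') [] = []"
| "contract u v (a, b, c) (a', b', c') (Node x p q r fb # st) =
    (if x = u then contract u v (a, b, c) (a', b', c') st
     else if x = v then contract u v (a, b, c) (a', b', c') st
     else Node x (reroute u v a a' p) (reroute u v b b' q) (reroute u v c c' r) fb
            # contract u v (a, b, c) (a', b', c') st)"

fun forbid :: "'v \<Rightarrow> 'v \<Rightarrow> 'v node list \<Rightarrow> 'v node list" where
  "forbid u v [] = []"
| "forbid u v (Node x a b c fb # st) =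
    (if x = u then Node x a b c (v # fb) else if x = v then Node x a b c (u # fb) else Node x a b c fb)
      # forbid u v st"

text \<open>
  As a decision tree: 3 plus the largest number of colors in which a permitted partner of the vertex
  can be its neighbor.
\<close>

definition node_capacity :: "'v \<Rightarrow> 'v \<Rightarrow> 'v \<Rightarrow> 'v list \<Rightarrow> nat" where
  "node_capacity a b c fb =
    (if mem a fb then (if mem b fb then (if mem c fb then 3 else 4) else if b = c then 5 else 4)
     else if a = b then (if b = c then 6 else 5) else if a = c then 5
     else if mem b fb then 4 else if b = c then 5 else 4)"

fun capacity :: "'v node list \<Rightarrow> nat" where
  "capacity [] = 0"
| "capacity (Node x a b c fb # st) = node_capacity a b c fb + capacity st"

text \<open>If no edge is permitted any more, every node has capacity 3, the least possible, so
  branching has nothing left to gain.\<close>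

fun pick_edge :: "'v node list \<Rightarrow> ('v \<times> 'v) option" where
  "pick_edge [] = None"
| "pick_edge (Node x a b c fb # st) =
    (if mem a fb then if mem b fb then if mem c fb then pick_edge st else Some (x, c) else Some (x, b)
     else Some (x, a))"

text \<open>
  The edge \<open>u v\<close> is in \<open>M\<close> and is contracted, or it is excluded. The subtraction may truncate to 0,
  but with \<open>T = 0\<close> no leaf succeeds.
\<close>

fun bounded :: "nat \<Rightarrow> nat \<Rightarrow> 'v node list \<Rightarrow> bool" where
  "bounded 0 T st = False"
| "bounded (Suc n) T st =
    (if capacity st < 4 * T then True
     else case pick_edge st of None \<Rightarrow> False
       | Some (u, v) \<Rightarrow> (case neighbors st u of None \<Rightarrow> False
         | Some (a, b, c) \<Rightarrow> (case neighbors st v of None \<Rightarrow> False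
           | Some t \<Rightarrow>
             if bounded n (T - multiplicity v a b c) (contract u v (a, b, c) t st)
             then bounded n T (forbid u v st) else False)))"

text \<open>Contracting a whole pairing edge by edge evaluates its number of cycles without
  computing any component.\<close>

fun gain :: "('v \<times> 'v) list \<Rightarrow> 'v node list \<Rightarrow> nat" where
  "gain [] st = 0"
| "gain ((u, v) # es) st =
    (case neighbors st u of None \<Rightarrow> 0
       | Some (a, b, c) \<Rightarrow> (case neighbors st v of None \<Rightarrow> 0
         | Some t \<Rightarrow> multiplicity v a b c + gain es (contract u v (a, b, c) t st)))"

definition state :: "('v \<Rightarrow> 'v) \<Rightarrow> ('v \<Rightarrow> 'v) \<Rightarrow> ('v \<Rightarrow> 'v) \<Rightarrow> 'v list \<Rightarrow> 'v node list" where
  "state p q r xs = map (\<lambda>x. Node x (p x) (q x) (r x) []) xs"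

text \<open>The pairing \<open>m\<close> enters through the exclusion lists only, so one node list
  stands for all pairings compatible with them.\<close>

definition represents ::
    "'v node list \<Rightarrow> 'v set \<Rightarrow> ('v \<Rightarrow> 'v) \<Rightarrow> ('v \<Rightarrow> 'v) \<Rightarrow> ('v \<Rightarrow> 'v) \<Rightarrow> ('v \<Rightarrow> 'v) \<Rightarrow> bool" where
  "represents st V m p q r \<longleftrightarrow> distinct (map key st) \<and> key ` set st = V \<and>
     (\<forall>x a b c fb. Node x a b c fb \<in> set st \<longrightarrow> a = p x \<and> b = q x \<and> c = r x \<and> m x \<notin> set fb)"

definition faces_with :: "'v set \<Rightarrow> ('v \<Rightarrow> 'v) \<Rightarrow> ('v \<Rightarrow> 'v) \<Rightarrow> ('v \<Rightarrow> 'v) \<Rightarrow> ('v \<Rightarrow> 'v) \<Rightarrow> nat" where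
  "faces_with V m p q r = num_components V m p + num_components V m q + num_components V m r"

section \<open>Soundness of the upper bound and of the lower bound\<close>

lemma mem_iff: "mem x xs \<longleftrightarrow> x \<in> set xs"
  by (induction xs) auto

lemma neighbors_SomeD: "neighbors st u = Some (a, b, c) \<Longrightarrow> \<exists>fb. Node u a b c fb \<in> set st"
  by (induction st u rule: neighbors.induct) (auto split: if_splits)

lemma represents_neighbors:
  assumes "represents st V m p q r" "neighbors st u = Some (a, b, c)"
  shows "u \<in> V" "a = p u" "b = q u" "c = r u"
proof -
  obtain fb where fb: "Node u a b c fb \<in> set st" using neighbors_SomeD assms(2) by metis
  then have "u \<in> key ` set st" by force
  then show "u \<in> V" "a = p u" "b = q u" "c = r u"
    using fb assms(1) unfolding represents_def by blast+
qed

lemma in_set_contractD: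
  "Node x a b c fb \<in> set (contract u v (pu, qu, ru) (pv, qv, rv) st) \<Longrightarrow>
     x \<noteq> u \<and> x \<noteq> v \<and> (\<exists>a' b' c'. Node x a' b' c' fb \<in> set st \<and> a = reroute u v pu pv a'
       \<and> b = reroute u v qu qv b' \<and> c = reroute u v ru rv c')"
proof (induction st)
  case (Cons nd st)
  show ?case
  proof (cases "Node x a b c fb \<in> set (contract u v (pu, qu, ru) (pv, qv, rv) st)")
    case True
    then show ?thesis using Cons.IH by auto
  next
    case False
    then show ?thesis using Cons.prems by (cases nd) (auto split: if_splits)
  qed
qed simp

lemma map_key_contract:
  "map key (contract u v t t' st) = filter (\<lambda>x. x \<noteq> u \<and> x \<noteq> v) (map key st)"
  by (induction u v t t' st rule: contract.induct) auto

lemma represents_contract: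
  assumes rep: "represents st V m p q r"
  shows "represents (contract u v (p u, q u, r u) (p v, q v, r v) st) (V - {u, v}) m
     (bypass u v p) (bypass u v q) (bypass u v r)"
proof -
  let ?st = "contract u v (p u, q u, r u) (p v, q v, r v) st"
  have "key ` set ?st = set (map key ?st)" by simp
  also have "\<dots> = V - {u, v}" using rep by (auto simp: map_key_contract represents_def)
  finally have "key ` set ?st = V - {u, v}" .
  then show ?thesis
    using rep unfolding represents_def map_key_contract bypass_def
    by (auto dest!: in_set_contractD)
qed

lemma in_set_forbidD:
  "Node x a b c fb \<in> set (forbid u v st) \<Longrightarrow>
     \<exists>fb'. Node x a b c fb' \<in> set st \<and> fb = (if x = u then v # fb' else if x = v then u # fb' else fb')"
proof (induction st)
  case (Cons nd st)
  show ?case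
  proof (cases "Node x a b c fb \<in> set (forbid u v st)")
    case True
    then show ?thesis using Cons.IH by auto
  next
    case False
    then show ?thesis using Cons.prems by (cases nd) (auto split: if_splits)
  qed
qed simp

lemma map_key_forbid: "map key (forbid u v st) = map key st"
  by (induction u v st rule: forbid.induct) auto

lemma represents_forbid:
  assumes rep: "represents st V m p q r" and "m u \<noteq> v" "m v \<noteq> u"
  shows "represents (forbid u v st) V m p q r"
proof -
  have "key ` set (forbid u v st) = key ` set st"
    by (metis map_key_forbid list.set_map)
  then show ?thesis
    using rep assms(2,3) unfolding represents_def map_key_forbid by (auto dest!: in_set_forbidD split: if_splits)
qed

lemma faces_with_contract:
  assumes "finite V" "invol_on V m" "invol_on V p" "invol_on V q" "invol_on V r" "u \<in> V" "m u = v"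
  shows "faces_with V m p q r = multiplicity v (p u) (q u) (r u)
     + faces_with (V - {u, v}) m (bypass u v p) (bypass u v q) (bypass u v r)"
  using num_components_contract[OF assms(1,2) _ assms(6,7)] assms(3-5)
  by (simp add: faces_with_def multiplicity_def)

lemma faces_with_bound:
  assumes V: "finite V" and "invol_on V m" "invol_on V p" "invol_on V q" "invol_on V r"
  shows "4 * faces_with V m p q r \<le> (\<Sum>x\<in>V. 3 + multiplicity (m x) (p x) (q x) (r x))"
proof -
  have D: "card {x \<in> V. f x = m x} = (\<Sum>x\<in>V. if f x = m x then 1 else 0)" for f
    using V by (simp add: sum.If_cases Int_def)
  have "(\<Sum>x\<in>V. 3 + multiplicity (m x) (p x) (q x) (r x)) = 3 * card V + card {x \<in> V. p x = m x}
      + card {x \<in> V. q x = m x} + card {x \<in> V. r x = m x}"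
    unfolding multiplicity_def D by (simp add: sum.distrib)
  then show ?thesis
    using num_components_bound[OF V assms(2,3)] num_components_bound[OF V assms(2,4)] num_components_bound[OF V assms(2,5)]
    by (simp add: faces_with_def)
qed

lemma multiplicity_le_node_capacity: "v \<notin> set fb \<Longrightarrow> 3 + multiplicity v a b c \<le> node_capacity a b c fb"
  by (auto simp: multiplicity_def node_capacity_def mem_iff)

lemma sum_le_capacity:
  assumes "represents st V m p q r"
  shows "(\<Sum>x\<in>V. 3 + multiplicity (m x) (p x) (q x) (r x)) \<le> capacity st"
proof -
  let ?f = "\<lambda>x. 3 + multiplicity (m x) (p x) (q x) (r x)"
  have st: "\<forall>x a b c fb. Node x a b c fb \<in> set st \<longrightarrow> a = p x \<and> b = q x \<and> c = r x \<and> m x \<notin> set fb"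
    using assms by (simp add: represents_def)
  have "(\<Sum>x\<in>V. ?f x) = sum_list (map ?f (map key st))"
    using assms sum_list_distinct_conv_sum_set[of "map key st" ?f] by (auto simp: represents_def)
  also have "\<dots> \<le> capacity st"
    using st
  proof (induction st rule: capacity.induct)
    case (2 x a b c fb st)
    then have "m x \<notin> set fb" "a = p x" "b = q x" "c = r x" by auto
    then have "?f x \<le> node_capacity a b c fb" using multiplicity_le_node_capacity by metis
    moreover have "sum_list (map ?f (map key st)) \<le> capacity st" using 2 by simp
    ultimately show ?case by simp
  qed simp
  finally show ?thesis .
qed

text \<open>A leaf compares four times the number of cycles with the capacity. At a branching,
  \<open>m\<close> either contains the picked edge, and the contracted list represents what is left,
  or it does not, and the exclusion is justified for both ends.\<close>

theorem bounded_sound: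
  assumes "bounded n T st" "represents st V m p q r"
    "finite V" "invol_on V m" "invol_on V p" "invol_on V q" "invol_on V r"
  shows "faces_with V m p q r < T"
  using assms
proof (induction n arbitrary: T st V p q r)
  case (Suc n)
  note inv = Suc.prems(3-7)
  show ?case
  proof (cases "capacity st < 4 * T")
    case True
    then show ?thesis
      using faces_with_bound[OF inv] sum_le_capacity[OF Suc.prems(2)] by linarith
  next
    case False
    with Suc.prems(1) obtain u v where pick_edge: "pick_edge st = Some (u, v)"
      by (cases "pick_edge st") auto
    with False Suc.prems(1) obtain a b c where lu: "neighbors st u = Some (a, b, c)"
      by (cases "neighbors st u") auto
    with pick_edge False Suc.prems(1) obtain a' b' c' where lv: "neighbors st v = Some (a', b', c')"
      by (cases "neighbors st v") auto
    have con: "bounded n (T - multiplicity v a b c) (contract u v (a, b, c) (a', b', c') st)"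
      and forbidden: "bounded n T (forbid u v st)"
      using Suc.prems(1) False by (simp_all add: pick_edge lu lv split: if_splits)
    note Lu = represents_neighbors[OF Suc.prems(2) lu]
    note Lv = represents_neighbors[OF Suc.prems(2) lv]
    show ?thesis
    proof (cases "m u = v")
      case True
      have uv: "u \<noteq> v" using invol_onD[OF inv(2) Lu(1)] True by auto
      have "faces_with (V - {u, v}) m (bypass u v p) (bypass u v q) (bypass u v r)
          < T - multiplicity v (p u) (q u) (r u)"
      proof (rule Suc.IH)
        show "bounded n (T - multiplicity v (p u) (q u) (r u))
            (contract u v (p u, q u, r u) (p v, q v, r v) st)"
          using con Lu Lv by simp
        show "represents (contract u v (p u, q u, r u) (p v, q v, r v) st) (V - {u, v}) m
            (bypass u v p) (bypass u v q) (bypass u v r)"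
          by (rule represents_contract) (rule Suc.prems)
      qed (use inv Lu(1) Lv(1) uv True in \<open>auto intro: invol_on_bypass invol_on_remove\<close>)
      then show ?thesis using faces_with_contract[OF inv Lu(1) True] by linarith
    next
      case False
      then have "m v \<noteq> u" using invol_onD[OF inv(2) Lv(1)] by auto
      then show ?thesis
        using Suc.IH[OF forbidden represents_forbid[OF Suc.prems(2) False] inv] by blast
    qed
  qed
qed simp

text \<open>Each contracted edge contributes exactly its multiplicity; whatever remains after the
  last edge or a failed lookup is counted as 0.\<close>

theorem gain_le:
  assumes "represents st V m p q r" "\<forall>(u, v)\<in>set es. m u = v"
    "finite V" "invol_on V m" "invol_on V p" "invol_on V q" "invol_on V r"
  shows "gain es st \<le> faces_with V m p q r"
  using assms
proof (induction es st arbitrary: V p q r rule: gain.induct)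
  case (2 u v es st)
  note inv = "2.prems"(3-7)
  show ?case
  proof (cases "neighbors st u = None \<or> neighbors st v = None")
    case True
    then show ?thesis by (auto split: option.splits)
  next
    case False
    then obtain a b c a' b' c' where lu: "neighbors st u = Some (a, b, c)" and lv: "neighbors st v = Some (a', b', c')"
      by auto
    note Lu = represents_neighbors[OF "2.prems"(1) lu] and Lv = represents_neighbors[OF "2.prems"(1) lv]
    have mu: "m u = v" using "2.prems"(2) by auto
    have uv: "u \<noteq> v" using invol_onD[OF inv(2) Lu(1)] mu by auto
    have "gain es (contract u v (a, b, c) (a', b', c') st)
        \<le> faces_with (V - {u, v}) m (bypass u v p) (bypass u v q) (bypass u v r)"
    proof (rule "2.IH"[OF lu _ _ lv])
      show "represents (contract u v (a, b, c) (a', b', c') st) (V - {u, v}) m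
          (bypass u v p) (bypass u v q) (bypass u v r)"
        using represents_contract[OF "2.prems"(1), of u v] Lu Lv by simp
    qed (use "2.prems"(2) inv Lu(1) Lv(1) uv mu in \<open>auto intro: invol_on_bypass invol_on_remove\<close>)
    then show ?thesis
      using lu lv Lu faces_with_contract[OF inv Lu(1) mu] by simp
  qed
qed simp

lemma represents_state:
  assumes "distinct xs"
  shows "represents (state p q r xs) (set xs) m p q r"
  using assms by (auto simp: represents_def state_def image_image comp_def)

section \<open>Graphs given by involutions\<close>

text \<open>Vertices are named by a finite type, so that the vertex set becomes \<open>UNIV\<close>
  and each color a map on names that can be tabulated.\<close>

definition coded :: "'a colored_graph \<Rightarrow> ('v::finite \<Rightarrow> 'a) \<Rightarrow> (nat \<Rightarrow> 'v \<Rightarrow> 'v) \<Rightarrow> bool" where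
  "coded G \<phi> P \<longleftrightarrow> bij_betw \<phi> UNIV (verts G) \<and>
     (\<forall>i\<in>{1,2,3}. invol_on UNIV (P i) \<and> edges G i = range (\<lambda>x. {\<phi> x, \<phi> (P i x)}))"

lemma codedD:
  assumes "coded G \<phi> P"
  shows "inj \<phi>" "verts G = range \<phi>"
    and "i \<in> {1,2,3} \<Longrightarrow> invol_on UNIV (P i)"
    and "i \<in> {1,2,3} \<Longrightarrow> edges G i = range (\<lambda>x. {\<phi> x, \<phi> (P i x)})"
  using assms by (auto simp: coded_def bij_betw_def)

lemma pair_eq_iff:
  assumes "inj \<phi>" "invol_on UNIV p"
  shows "{\<phi> x, \<phi> (p x)} = {\<phi> y, \<phi> (p y)} \<longleftrightarrow> y = x \<or> y = p x"
  using invol_onD[OF assms(2), of x] invol_onD[OF assms(2), of y] inj_eq[OF assms(1)]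
  by (auto simp: doubleton_eq_iff)

lemma pairing_range:
  assumes "inj \<phi>" "invol_on UNIV p"
  shows "pairing (range \<phi>) (range (\<lambda>x. {\<phi> x, \<phi> (p x)}))"
  unfolding pairing_def
proof
  show "partition_on (range \<phi>) (range (\<lambda>x. {\<phi> x, \<phi> (p x)}))"
  proof (rule partition_onI)
    fix e f assume "e \<in> range (\<lambda>x. {\<phi> x, \<phi> (p x)})" "f \<in> range (\<lambda>x. {\<phi> x, \<phi> (p x)})" "e \<noteq> f"
    then obtain x y where xy: "e = {\<phi> x, \<phi> (p x)}" "f = {\<phi> y, \<phi> (p y)}" by auto
    then have "y \<noteq> x \<and> y \<noteq> p x" using \<open>e \<noteq> f\<close> pair_eq_iff[OF assms] by auto
    then show "disjnt e f"
      using xy invol_onD[OF assms(2), of x] invol_onD[OF assms(2), of y] inj_eq[OF assms(1)]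
      by (auto simp: disjnt_def)
  qed auto
  show "\<forall>e\<in>range (\<lambda>x. {\<phi> x, \<phi> (p x)}). card e = 2"
    using invol_onD[OF assms(2)] inj_eq[OF assms(1)] by (auto simp: card_2_iff) metis
qed

lemma pairing_obtain_invol:
  assumes M: "pairing (range \<phi>) M" and inj: "inj \<phi>"
  obtains m where "invol_on UNIV m" "M = range (\<lambda>x. {\<phi> x, \<phi> (m x)})"
proof -
  have part: "partition_on (range \<phi>) M" and two: "\<And>e. e \<in> M \<Longrightarrow> card e = 2"
    using M by (auto simp: pairing_def)
  have uniq: "e = f" if "e \<in> M" "f \<in> M" "z \<in> e" "z \<in> f" for e f z
    using partition_onD2[OF part] that by (auto simp: disjoint_def)
  have "\<exists>y. y \<noteq> x \<and> {\<phi> x, \<phi> y} \<in> M" for x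
  proof -
    obtain e where e: "e \<in> M" "\<phi> x \<in> e" using partition_onD1[OF part] by blast
    then obtain z where z: "e = {\<phi> x, z}" "z \<noteq> \<phi> x" using two[OF e(1)] by (auto simp: card_2_iff)
    have "z \<in> range \<phi>" using z e partition_onD1[OF part] by blast
    then show ?thesis using z e by auto
  qed
  then obtain m where m: "\<And>x. m x \<noteq> x" "\<And>x. {\<phi> x, \<phi> (m x)} \<in> M" by metis
  have "m (m x) = x" for x
  proof -
    have "{\<phi> x, \<phi> (m x)} = {\<phi> (m x), \<phi> (m (m x))}"
      using uniq[OF m(2) m(2), of "\<phi> (m x)" x "m x"] by simp
    then show ?thesis using m(1)[of x] inj_eq[OF inj] by (auto simp: doubleton_eq_iff)
  qed
  then have "invol_on UNIV m" using m by (auto simp: invol_on_def)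
  moreover have "M = range (\<lambda>x. {\<phi> x, \<phi> (m x)})"
  proof
    show "M \<subseteq> range (\<lambda>x. {\<phi> x, \<phi> (m x)})"
    proof
      fix e assume e: "e \<in> M"
      then obtain z where z: "z \<in> e" using two[OF e] by (auto simp: card_2_iff)
      then obtain x where "z = \<phi> x" using e partition_onD1[OF part] by blast
      then have "e = {\<phi> x, \<phi> (m x)}" using uniq[OF e m(2) z] by simp
      then show "e \<in> range (\<lambda>x. {\<phi> x, \<phi> (m x)})" by simp
    qed
  qed (use m in auto)
  ultimately show ?thesis using that by blast
qed

definition component :: "('v \<Rightarrow> 'v) \<Rightarrow> ('v \<Rightarrow> 'v) \<Rightarrow> 'v \<Rightarrow> 'v set" where
  "component p q x = (link UNIV p q)\<^sup>* `` {x}"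

lemma component_self: "x \<in> component p q x"
  by (simp add: component_def)

lemma component_step:
  assumes "y \<in> component p q x"
  shows "p y \<in> component p q x" "q y \<in> component p q x"
proof -
  have "(y, p y) \<in> link UNIV p q" "(y, q y) \<in> link UNIV p q" by (auto simp: link_def)
  then show "p y \<in> component p q x" "q y \<in> component p q x"
    using assms by (auto simp: component_def intro: rtrancl.rtrancl_into_rtrancl)
qed

lemma component_subset:
  assumes "x \<in> A" and "\<And>y. y \<in> A \<Longrightarrow> p y \<in> A \<and> q y \<in> A"
  shows "component p q x \<subseteq> A"
proof
  fix y assume "y \<in> component p q x"
  then have "(x, y) \<in> (link UNIV p q)\<^sup>*" by (simp add: component_def)
  then show "y \<in> A" by (induction rule: rtrancl_induct) (use assms in \<open>auto simp: link_def\<close>)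
qed

lemma component_commute: "component p q x = component q p x"
proof -
  have "link UNIV p q = link UNIV q p" by (auto simp: link_def)
  then show ?thesis by (simp add: component_def)
qed

text \<open>The adjacency of \<open>H\<close> is the image of \<open>link\<close> under
  \<open>\<phi>\<close>, so classes go to classes. \<open>H\<close> is kept general because it is
  both the graph itself and the graph with a pairing added as color 0.\<close>

lemma faces_of_invols:
  assumes inj: "inj \<phi>" and p: "invol_on UNIV p" and q: "invol_on UNIV q"
    and V: "verts H = range \<phi>"
    and i: "edges H i = range (\<lambda>x. {\<phi> x, \<phi> (p x)})" and j: "edges H j = range (\<lambda>x. {\<phi> x, \<phi> (q x)})"
  shows "faces H i j = range (\<lambda>x. \<phi> ` component p q x)"
proof -
  have edge: "{\<phi> x, z} \<in> range (\<lambda>x. {\<phi> x, \<phi> (f x)}) \<longleftrightarrow> z = \<phi> (f x)"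
    if f: "invol_on UNIV f" for f x z
  proof
    assume "{\<phi> x, z} \<in> range (\<lambda>x. {\<phi> x, \<phi> (f x)})"
    then obtain y where "{\<phi> x, z} = {\<phi> y, \<phi> (f y)}" by auto
    then show "z = \<phi> (f x)"
      using invol_onD[OF f, of y] inj_eq[OF inj] by (auto simp: doubleton_eq_iff)
  qed auto
  have adj: "(\<phi> x, z) \<in> adjacency H i j \<longleftrightarrow> (\<exists>y. z = \<phi> y \<and> (x, y) \<in> link UNIV p q)" for x z
    unfolding adjacency_def i j using edge[OF p] edge[OF q] by (auto simp: link_def)
  have "(adjacency H i j)\<^sup>* `` {\<phi> x} = \<phi> ` component p q x" for x
  proof
    show "(adjacency H i j)\<^sup>* `` {\<phi> x} \<subseteq> \<phi> ` component p q x"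
    proof
      fix z assume "z \<in> (adjacency H i j)\<^sup>* `` {\<phi> x}"
      then have "(\<phi> x, z) \<in> (adjacency H i j)\<^sup>*" by simp
      then show "z \<in> \<phi> ` component p q x"
      proof (induction rule: rtrancl_induct)
        case base
        show ?case using component_self by (rule imageI)
      next
        case (step y z)
        then obtain w w' where "y = \<phi> w" "w \<in> component p q x" "z = \<phi> w'" "(w, w') \<in> link UNIV p q"
          using adj by blast
        then show ?case using component_step[of w p q x] by (auto simp: link_def)
      qed
    qed
    show "\<phi> ` component p q x \<subseteq> (adjacency H i j)\<^sup>* `` {\<phi> x}"
    proof
      fix z assume "z \<in> \<phi> ` component p q x"
      then obtain y where y: "z = \<phi> y" "(x, y) \<in> (link UNIV p q)\<^sup>*" by (auto simp: component_def)
      have "(\<phi> x, \<phi> y) \<in> (adjacency H i j)\<^sup>*"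
        by (rule rtrancl_map[OF y(2)]) (use adj in blast)
      then show "z \<in> (adjacency H i j)\<^sup>* `` {\<phi> x}" using y by simp
    qed
  qed
  then show ?thesis unfolding faces_def V quotient_def by auto
qed

lemma card_range_component: "inj \<phi> \<Longrightarrow> card (range (\<lambda>x. \<phi> ` component p q x)) = num_components UNIV p q"
proof -
  assume inj: "inj \<phi>"
  have "range (\<lambda>x. \<phi> ` component p q x) = image \<phi> ` (UNIV // (link UNIV p q)\<^sup>*)"
    by (auto simp: quotient_def component_def)
  moreover have "inj_on (image \<phi>) A" for A
    using inj by (auto intro: inj_onI simp: inj_image_eq_iff)
  ultimately show ?thesis by (simp add: num_components_def card_image)
qed

lemma faces_coded:
  assumes "coded G \<phi> P" "i \<in> {1,2,3}" "j \<in> {1,2,3}"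
  shows "faces G i j = range (\<lambda>x. \<phi> ` component (P i) (P j) x)"
  using assms codedD[OF assms(1)] by (intro faces_of_invols) blast+

lemma F_sum_coded:
  assumes G: "coded G \<phi> P" and m: "invol_on UNIV m"
  shows "F_sum (range (\<lambda>x. {\<phi> x, \<phi> (m x)})) G = faces_with UNIV m (P 1) (P 2) (P 3)"
proof -
  let ?M = "range (\<lambda>x. {\<phi> x, \<phi> (m x)})"
  have "card (faces (add_pairing G ?M) 0 i) = num_components UNIV m (P i)" if "i \<in> {1,2,3}" for i
  proof -
    have "faces (add_pairing G ?M) 0 i = range (\<lambda>x. \<phi> ` component m (P i) x)"
      using that codedD[OF G] m by (intro faces_of_invols) (auto simp: add_pairing_def)
    then show ?thesis using card_range_component codedD(1)[OF G] by metis
  qed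
  then show ?thesis by (simp add: F_sum_def faces_with_def)
qed

lemma F_sum_image_coded:
  assumes G: "coded G \<phi> P"
  shows "{F_sum M G | M. pairing (verts G) M} = {faces_with UNIV m (P 1) (P 2) (P 3) | m. invol_on UNIV m}"
    (is "?A = ?B")
proof
  show "?A \<subseteq> ?B"
  proof
    fix k assume "k \<in> ?A"
    then obtain M where M: "pairing (range \<phi>) M" "k = F_sum M G" using codedD[OF G] by auto
    obtain m where "invol_on UNIV m" "M = range (\<lambda>x. {\<phi> x, \<phi> (m x)})"
      by (rule pairing_obtain_invol[OF M(1) codedD(1)[OF G]])
    then show "k \<in> ?B" using F_sum_coded[OF G] M(2) by auto
  qed
  show "?B \<subseteq> ?A"
  proof
    fix k assume "k \<in> ?B"
    then obtain m where m: "invol_on UNIV m" and k: "k = faces_with UNIV m (P 1) (P 2) (P 3)" by auto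
    have "pairing (verts G) (range (\<lambda>x. {\<phi> x, \<phi> (m x)}))"
      using pairing_range[OF codedD(1)[OF G] m] codedD(2)[OF G] by simp
    moreover have "k = F_sum (range (\<lambda>x. {\<phi> x, \<phi> (m x)})) G" using F_sum_coded[OF G m] k by simp
    ultimately show "k \<in> ?A" by (intro CollectI exI conjI)
  qed
qed

lemma F_max_coded:
  assumes "coded G (\<phi> :: 'v::finite \<Rightarrow> 'a) P"
  shows "F_max G = Max {faces_with UNIV m (P 1) (P 2) (P 3) | m. invol_on UNIV m}"
    and "finite {faces_with UNIV m (P 1) (P 2) (P 3) | m. invol_on UNIV m}"
proof -
  show "F_max G = Max {faces_with UNIV m (P 1) (P 2) (P 3) | m. invol_on UNIV m}"
    unfolding F_max_def F_sum_image_coded[OF assms] ..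
  have "finite (range (\<lambda>m :: 'v \<Rightarrow> 'v. faces_with UNIV m (P 1) (P 2) (P 3)))" by simp
  then show "finite {faces_with UNIV m (P 1) (P 2) (P 3) | m. invol_on UNIV m}"
    by (rule rev_finite_subset) auto
qed

lemma regular_coded:
  assumes G: "coded G (\<phi> :: 'v::finite \<Rightarrow> 'a) P" and "card (UNIV :: 'v::finite set) = 2 * n"
  shows "regular_3_edge_colored n G"
proof -
  have "pairing (verts G) (edges G i)" if "i \<in> {1,2,3}" for i
    using pairing_range[OF codedD(1)[OF G] codedD(3)[OF G that]] codedD(2,4)[OF G] that by simp
  moreover have "card (verts G) = 2 * n"
    using assms codedD(1,2)[OF G] by (simp add: card_image)
  ultimately show ?thesis
    unfolding regular_3_edge_colored_def using codedD(2)[OF G] by auto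
qed

lemma obtain_coding:
  assumes reg: "regular_3_edge_colored n G" and "card (UNIV :: 'v::finite set) = 2 * n"
  obtains \<phi> :: "'v::finite \<Rightarrow> 'a" and P where "coded G \<phi> P"
proof -
  have fin: "finite (verts G)" "card (verts G) = card (UNIV :: 'v set)"
    using assms by (auto simp: regular_3_edge_colored_def)
  then obtain \<phi> :: "'v \<Rightarrow> 'a" where \<phi>: "bij_betw \<phi> UNIV (verts G)"
    using finite_same_card_bij[of "UNIV :: 'v set" "verts G"] by auto
  have "\<exists>p. invol_on UNIV p \<and> edges G i = range (\<lambda>x. {\<phi> x, \<phi> (p x)})" if "i \<in> {1,2,3}" for i
  proof -
    have "pairing (range \<phi>) (edges G i)"
      using reg that \<phi> by (auto simp: regular_3_edge_colored_def bij_betw_def)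
    then show ?thesis using pairing_obtain_invol \<phi> by (metis bij_betw_def)
  qed
  then obtain P where "\<And>i. i \<in> {1,2,3} \<Longrightarrow> invol_on UNIV (P i) \<and> edges G i = range (\<lambda>x. {\<phi> x, \<phi> (P i x)})"
    by metis
  then have "coded G \<phi> P" using \<phi> by (simp add: coded_def)
  then show ?thesis by (rule that)
qed

text \<open>Renaming replaces each color by its conjugate under \<open>\<sigma>\<close>. This serves
  to bring colors 1, 2 into standard form and later to apply a symmetry of that form.\<close>

lemma coded_relabel:
  assumes G: "coded G (\<phi> :: 'v::finite \<Rightarrow> 'a) P" and \<sigma>: "bij (\<sigma> :: 'w::finite \<Rightarrow> 'v)"
    and Q: "\<And>i x. i \<in> {1,2,3} \<Longrightarrow> P i (\<sigma> x) = \<sigma> (Q i x)"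
  shows "coded G (\<phi> \<circ> \<sigma>) Q"
  unfolding coded_def
proof (intro conjI ballI)
  show "bij_betw (\<phi> \<circ> \<sigma>) UNIV (verts G)"
    using \<sigma> G by (auto simp: coded_def intro: bij_betw_trans)
  fix i :: nat assume i: "i \<in> {1,2,3}"
  show "invol_on UNIV (Q i)"
    using invol_onD[OF codedD(3)[OF G i]] Q[OF i] bij_is_inj[OF \<sigma>] unfolding invol_on_def
    by (metis UNIV_I injD)
  have "edges G i = (\<lambda>x. {\<phi> x, \<phi> (P i x)}) ` range \<sigma>"
    using codedD(4)[OF G i] bij_is_surj[OF \<sigma>] by simp
  also have "\<dots> = range (\<lambda>x. {(\<phi> \<circ> \<sigma>) x, (\<phi> \<circ> \<sigma>) (Q i x)})"
    using Q[OF i] by (simp add: image_image)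
  finally show "edges G i = range (\<lambda>x. {(\<phi> \<circ> \<sigma>) x, (\<phi> \<circ> \<sigma>) (Q i x)})" .
qed

lemma isomorphic_coded:
  assumes G: "coded G \<phi> P" and H: "coded H \<psi> Q" and PQ: "\<And>i. i \<in> {1,2,3} \<Longrightarrow> P i = Q i"
  shows "isomorphic G H"
  unfolding isomorphic_def
proof (intro exI conjI ballI)
  let ?f = "\<psi> \<circ> inv \<phi>"
  have inv: "inv \<phi> (\<phi> x) = x" for x using codedD(1)[OF G] by simp
  show "bij_betw ?f (verts G) (verts H)"
  proof (rule bij_betw_trans)
    show "bij_betw (inv \<phi>) (verts G) UNIV"
      using G by (auto simp: coded_def intro: bij_betw_inv_into)
    show "bij_betw \<psi> UNIV (verts H)" using H by (simp add: coded_def)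
  qed
  fix i :: nat assume i: "i \<in> {1,2,3}"
  show "(\<lambda>e. ?f ` e) ` edges G i = edges H i"
    unfolding codedD(4)[OF G i] codedD(4)[OF H i] by (simp add: image_image inv PQ[OF i])
qed

section \<open>Face lengths and shared edges in terms of vertex counts\<close>

lemma card_pairs_on:
  assumes inj: "inj \<phi>" and p: "invol_on UNIV p" and A: "finite A" "\<And>x. x \<in> A \<Longrightarrow> p x \<in> A"
  shows "2 * card ((\<lambda>x. {\<phi> x, \<phi> (p x)}) ` A) = card A"
proof -
  let ?E = "(\<lambda>x. {\<phi> x, \<phi> (p x)}) ` A"
  have part: "partition_on (range \<phi>) (range (\<lambda>x. {\<phi> x, \<phi> (p x)}))"
    and two: "\<And>x. card {\<phi> x, \<phi> (p x)} = 2"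
    using pairing_range[OF inj p] by (auto simp: pairing_def)
  have "2 * card ?E = card (\<Union>?E)"
  proof (rule card_partition)
    show "e \<inter> f = {}" if "e \<in> ?E" "f \<in> ?E" "e \<noteq> f" for e f
      using partition_onD2[OF part] that by (auto simp: disjoint_def)
  qed (use A two in auto)
  also have "\<Union>?E = \<phi> ` A" using A by auto
  finally show ?thesis using inj by (simp add: card_image inj_on_subset[OF inj])
qed

text \<open>A component that contains one end of an edge of color \<open>i\<close> or
  \<open>j\<close> contains the other end too, so its edges are those that start at its
  vertices.\<close>

lemma face_edges_coded:
  assumes G: "coded G \<phi> P" and ij: "i \<in> {1,2,3}" "j \<in> {1,2,3}"
  shows "face_edges G i j (\<phi> ` component (P i) (P j) x) =
    {i} \<times> (\<lambda>y. {\<phi> y, \<phi> (P i y)}) ` component (P i) (P j) x \<union>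
    {j} \<times> (\<lambda>y. {\<phi> y, \<phi> (P j y)}) ` component (P i) (P j) x"
proof -
  have "{e \<in> edges G c. e \<subseteq> \<phi> ` component (P i) (P j) x} = (\<lambda>y. {\<phi> y, \<phi> (P c y)}) ` component (P i) (P j) x"
    if "c \<in> {i, j}" for c
  proof -
    have c: "c \<in> {1,2,3}" using that ij by auto
    show ?thesis
      unfolding codedD(4)[OF G c] using component_step that codedD(1)[OF G]
      by (auto simp: inj_image_mem_iff)
  qed
  then have E: "{e \<in> edges G i. e \<subseteq> \<phi> ` component (P i) (P j) x} = (\<lambda>y. {\<phi> y, \<phi> (P i y)}) ` component (P i) (P j) x"
    "{e \<in> edges G j. e \<subseteq> \<phi> ` component (P i) (P j) x} = (\<lambda>y. {\<phi> y, \<phi> (P j y)}) ` component (P i) (P j) x"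
    by simp_all
  have "face_edges G i j X = {i} \<times> {e \<in> edges G i. e \<subseteq> X} \<union> {j} \<times> {e \<in> edges G j. e \<subseteq> X}" for X
    by (auto simp: face_edges_def)
  then show ?thesis unfolding E[symmetric] .
qed

text \<open>Each of the two colors pairs up the vertices of the face and so has half as many edges
  as there are vertices. The color tags keep the two halves disjoint.\<close>

lemma face_length_coded:
  assumes G: "coded G (\<phi> :: 'v::finite \<Rightarrow> 'a) P" and ij: "i \<in> {1,2,3}" "j \<in> {1,2,3}" "i \<noteq> j"
  shows "face_length G i j (\<phi> ` component (P i) (P j) x) = card (component (P i) (P j) x)"
proof -
  let ?C = "component (P i) (P j) x"
  have "2 * card ((\<lambda>y. {\<phi> y, \<phi> (P c y)}) ` ?C) = card ?C" if "c \<in> {i, j}" for c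
    using that ij component_step codedD[OF G] by (intro card_pairs_on) auto
  from this[of i] this[of j] show ?thesis
    unfolding face_length_def face_edges_coded[OF G ij(1,2)]
    by (subst card_Un_disjoint) (use ij(3) in \<open>auto simp: card_cartesian_product_singleton\<close>)
qed

text \<open>Only edges of the common color \<open>i\<close> can be shared, and these pair up the
  common vertices. So sharing two edges means having four common vertices.\<close>

lemma shared_edges_coded:
  assumes G: "coded G (\<phi> :: 'v::finite \<Rightarrow> 'a) P" and ijk: "i \<in> {1,2,3}" "j \<in> {1,2,3}" "k \<in> {1,2,3}"
    and ne: "i \<noteq> j" "i \<noteq> k" "j \<noteq> k"
  shows "2 * card (face_edges G i j (\<phi> ` component (P i) (P j) x) \<inter> face_edges G i k (\<phi> ` component (P i) (P k) y))
    = card (component (P i) (P j) x \<inter> component (P i) (P k) y)"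
proof -
  let ?C = "component (P i) (P j) x" and ?D = "component (P i) (P k) y" and ?e = "\<lambda>z. {\<phi> z, \<phi> (P i z)}"
  have "?e ` ?C \<inter> ?e ` ?D = ?e ` (?C \<inter> ?D)"
  proof
    show "?e ` ?C \<inter> ?e ` ?D \<subseteq> ?e ` (?C \<inter> ?D)"
    proof
      fix e assume "e \<in> ?e ` ?C \<inter> ?e ` ?D"
      then obtain z w where z: "z \<in> ?C" "e = ?e z" and w: "w \<in> ?D" "e = ?e w" by auto
      then have "w = z \<or> w = P i z"
        using pair_eq_iff[OF codedD(1)[OF G] codedD(3)[OF G ijk(1)]] by blast
      then have "w \<in> ?C" using z(1) component_step(1)[OF z(1)] by auto
      then show "e \<in> ?e ` (?C \<inter> ?D)" using w by blast
    qed
  qed auto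
  then have "face_edges G i j (\<phi> ` ?C) \<inter> face_edges G i k (\<phi> ` ?D) = {i} \<times> ?e ` (?C \<inter> ?D)"
    unfolding face_edges_coded[OF G ijk(1,2)] face_edges_coded[OF G ijk(1,3)] using ne by blast
  moreover have "2 * card (?e ` (?C \<inter> ?D)) = card (?C \<inter> ?D)"
    using ijk component_step codedD[OF G] by (intro card_pairs_on) auto
  ultimately show ?thesis by (simp add: card_cartesian_product_singleton)
qed

section \<open>Faces of length eight\<close>

fun alternate :: "('v \<Rightarrow> 'v) \<Rightarrow> ('v \<Rightarrow> 'v) \<Rightarrow> 'v \<Rightarrow> nat \<Rightarrow> 'v" where
  "alternate p q x 0 = x"
| "alternate p q x (Suc k) = alternate q p (p x) k"

declare alternate.simps(2) [simp del]

text \<open>The defining equation peels off the first step of the walk; here the last one is split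
  off, and its color depends on parity.\<close>

lemma alternate_Suc: "alternate p q x (Suc k) = (if even k then p else q) (alternate p q x k)"
proof (induction k arbitrary: p q x)
  case (Suc k)
  have "alternate p q x (Suc (Suc k)) = alternate q p (p x) (Suc k)" by (simp only: alternate.simps)
  also have "\<dots> = (if even k then q else p) (alternate q p (p x) k)" by (rule Suc.IH)
  finally show ?case by (simp add: alternate.simps(2))
qed (simp add: alternate.simps(2))

lemma alternate_back:
  assumes "invol_on UNIV p" "invol_on UNIV q"
  shows "(if even k then p else q) (alternate p q x (Suc k)) = alternate p q x k"
  unfolding alternate_Suc using invol_onD(3)[OF assms(1)] invol_onD(3)[OF assms(2)] by simp

lemma alternate_in_component: "alternate p q x k \<in> component p q x"
proof (induction k)
  case (Suc k)
  then show ?case unfolding alternate_Suc using component_step[OF Suc] by simp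
qed (simp add: component_self)

text \<open>In a stretch of odd length the first and the last step have the same color. If its ends
  coincided, both could be moved inward by that color, until a single step would be a fixed point of
  \<open>p\<close> or \<open>q\<close>.\<close>

lemma alternate_neq_odd:
  assumes "invol_on UNIV p" "invol_on UNIV q"
  shows "alternate p q x (i + Suc (2 * d)) \<noteq> alternate p q x i"
proof (induction d arbitrary: i)
  case 0
  show ?case
    using invol_onD(2)[OF assms(1)] invol_onD(2)[OF assms(2)] alternate_Suc[of p q x i] by simp
next
  case (Suc d)
  show ?case
  proof
    let ?f = "if even i then p else q"
    assume "alternate p q x (i + Suc (2 * Suc d)) = alternate p q x i"
    then have "?f (alternate p q x (Suc (Suc i + Suc (2 * d)))) = ?f (alternate p q x i)" by simp
    moreover have "?f (alternate p q x (Suc (Suc i + Suc (2 * d)))) = alternate p q x (Suc i + Suc (2 * d))"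
      using alternate_back[OF assms, of "Suc i + Suc (2 * d)"] by simp
    ultimately show False using Suc.IH[of "Suc i"] alternate_Suc[of p q x i] by simp
  qed
qed

text \<open>The steps leading to two indices of equal parity have the same color, so a coincidence
  can be moved back to index 0.\<close>

lemma alternate_shift_back:
  assumes "invol_on UNIV p" "invol_on UNIV q" "alternate p q x (i + 2 * d) = alternate p q x i"
  shows "alternate p q x (2 * d) = x"
  using assms(3)
proof (induction i)
  case (Suc i)
  let ?f = "if even i then p else q"
  have "?f (alternate p q x (Suc (i + 2 * d))) = alternate p q x (i + 2 * d)"
    using alternate_back[OF assms(1,2), of "i + 2 * d"] by simp
  moreover have "?f (alternate p q x (Suc i)) = alternate p q x i" by (rule alternate_back[OF assms(1,2)])
  ultimately show ?case using Suc by simp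
qed simp

text \<open>At each vertex of the closed walk, one color leads one step forward and the other one
  step back, cyclically. So the walk is closed under both.\<close>

lemma component_eq_alternate:
  assumes p: "invol_on UNIV p" and q: "invol_on UNIV q" and d: "alternate p q x (2 * d) = x" "0 < d"
  shows "component p q x = alternate p q x ` {..<2 * d}"
proof
  let ?s = "alternate p q x"
  have reverse: "(if even k then p else q) (?s (Suc k)) = ?s k" for k by (rule alternate_back[OF p q])
  show "component p q x \<subseteq> ?s ` {..<2 * d}"
  proof (rule component_subset)
    show "x \<in> ?s ` {..<2 * d}" using d by (intro image_eqI[where x = 0]) auto
    fix y assume "y \<in> ?s ` {..<2 * d}"
    then obtain k where k: "k < 2 * d" "y = ?s k" by auto
    have up: "?s (Suc k) \<in> ?s ` {..<2 * d}"
    proof (cases "Suc k = 2 * d")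
      case True
      then have "?s (Suc k) = ?s 0" using d by simp
      then show ?thesis using d by (intro image_eqI[where x = 0]) auto
    qed (use k in auto)
    have down: "(if even k then q else p) y \<in> ?s ` {..<2 * d}"
    proof (cases k)
      case 0
      \<comment> \<open>From the start, the step back wraps around to index
        \<open>2 * d - 1\<close>; this index is odd, so the step has color \<open>q\<close>.\<close>
      obtain e where "2 * d = Suc e" "odd e" using d(2) by (cases d) auto
      then have "q y = ?s e" "e < 2 * d" using reverse[of e] d k 0 by auto
      then show ?thesis using 0 by auto
    next
      case (Suc j)
      then have "(if even k then q else p) y = ?s j" using reverse[of j] k by auto
      then show ?thesis using Suc k by auto
    qed
    show "p y \<in> ?s ` {..<2 * d} \<and> q y \<in> ?s ` {..<2 * d}"
      using up down k by (cases "even k") (simp_all add: alternate_Suc)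
  qed
  show "?s ` {..<2 * d} \<subseteq> component p q x" using alternate_in_component by auto
qed

text \<open>A coincidence on the walk has an even gap and makes the component no larger than this
  gap, so the gap is at least 8. Hence the first eight vertices are distinct and fill the
  component.\<close>

lemma alternate_octagon:
  assumes p: "invol_on UNIV p" and q: "invol_on UNIV q" and c: "card (component p q x) = 8"
  shows "inj_on (alternate p q x) {..<8}" "alternate p q x 8 = x" "component p q x = alternate p q x ` {..<8}"
proof -
  let ?s = "alternate p q x"
  have small: "8 \<le> 2 * d" if "?s (2 * d) = x" "0 < d" for d
  proof -
    have "card (?s ` {..<2 * d}) \<le> card {..<2 * d}" by (rule card_image_le) simp
    then show ?thesis using c component_eq_alternate[OF p q that] by simp
  qed
  have gap: "8 + i \<le> j" if "?s j = ?s i" "i < j" for i j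
  proof (cases "even (j - i)")
    case True
    then obtain d where "j - i = 2 * d" by (elim evenE)
    then have j: "j = i + 2 * d" using that by simp
    then show ?thesis using small[of d] alternate_shift_back[OF p q, of x i d] that by simp
  next
    case False
    then obtain d where "j - i = 2 * d + 1" by (elim oddE)
    then have "j = i + Suc (2 * d)" using that by simp
    then show ?thesis using alternate_neq_odd[OF p q] that by blast
  qed
  show inj: "inj_on ?s {..<8}"
  proof (rule inj_onI)
    fix i j assume ij: "i \<in> {..<8}" "j \<in> {..<8}" "?s i = ?s j"
    have "\<not> i < j" using gap[of j i] ij by auto
    moreover have "\<not> j < i" using gap[of i j] ij by auto
    ultimately show "i = j" by simp
  qed
  have "?s ` {..<8} \<subseteq> component p q x" using alternate_in_component by auto
  moreover have "card (?s ` {..<8}) = card (component p q x)" using c card_image[OF inj] by simp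
  moreover have "finite (component p q x)" using c by (simp add: card_ge_0_finite)
  ultimately show component: "component p q x = ?s ` {..<8}" by (metis card_subset_eq)
  have "?s 8 \<in> ?s ` {..<8}" using alternate_in_component[of p q x 8] component by simp
  then obtain j where "j < 8" "?s 8 = ?s j" by auto
  \<comment> \<open>By \<open>gap\<close>, a coincidence of index 8 with \<open>j < 8\<close>
    requires \<open>8 + j \<le> 8\<close>, so \<open>j\<close> is 0.\<close>
  then show "?s 8 = x" using gap[of 8 j] by simp
qed

lemma component_disjoint:
  assumes "invol_on UNIV p" "invol_on UNIV q" "y \<notin> component p q x"
  shows "component p q x \<inter> component p q y = {}"
proof -
  note eq = rtrancl_Image_eq[OF sym_link[OF assms(1,2)]]
  have "y \<in> component p q x" if "z \<in> component p q x" "z \<in> component p q y" for z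
  proof -
    have "component p q x = component p q z" "component p q y = component p q z"
      using that eq unfolding component_def by blast+
    then show ?thesis using component_self by metis
  qed
  then show ?thesis using assms(3) by blast
qed

section \<open>Sixteen labels\<close>

datatype lab = L1 | L2 | L3 | L4 | L5 | L6 | L7 | L8 | L9 | L10 | L11 | L12 | L13 | L14 | L15 | L16

definition labs :: "lab list" where
  "labs = [L1, L2, L3, L4, L5, L6, L7, L8, L9, L10, L11, L12, L13, L14, L15, L16]"

fun std_color1 :: "lab \<Rightarrow> lab" where
  "std_color1 L1 = L2" | "std_color1 L2 = L1" | "std_color1 L3 = L4" | "std_color1 L4 = L3"
| "std_color1 L5 = L6" | "std_color1 L6 = L5" | "std_color1 L7 = L8" | "std_color1 L8 = L7"
| "std_color1 L9 = L10" | "std_color1 L10 = L9" | "std_color1 L11 = L12" | "std_color1 L12 = L11"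
| "std_color1 L13 = L14" | "std_color1 L14 = L13" | "std_color1 L15 = L16" | "std_color1 L16 = L15"

fun std_color2 :: "lab \<Rightarrow> lab" where
  "std_color2 L1 = L8" | "std_color2 L2 = L3" | "std_color2 L3 = L2" | "std_color2 L4 = L5"
| "std_color2 L5 = L4" | "std_color2 L6 = L7" | "std_color2 L7 = L6" | "std_color2 L8 = L1"
| "std_color2 L9 = L16" | "std_color2 L10 = L11" | "std_color2 L11 = L10" | "std_color2 L12 = L13"
| "std_color2 L13 = L12" | "std_color2 L14 = L15" | "std_color2 L15 = L14" | "std_color2 L16 = L9"

fun ex_color3 :: "lab \<Rightarrow> lab" where
  "ex_color3 L1 = L3" | "ex_color3 L2 = L9" | "ex_color3 L3 = L1" | "ex_color3 L4 = L11"
| "ex_color3 L5 = L7" | "ex_color3 L6 = L13" | "ex_color3 L7 = L5" | "ex_color3 L8 = L15"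
| "ex_color3 L9 = L2" | "ex_color3 L10 = L12" | "ex_color3 L11 = L4" | "ex_color3 L12 = L10"
| "ex_color3 L13 = L6" | "ex_color3 L14 = L16" | "ex_color3 L15 = L8" | "ex_color3 L16 = L14"

lemma set_labs: "set labs = UNIV"
proof -
  have "x \<in> set labs" for x by (cases x) (simp_all add: labs_def)
  then show ?thesis by blast
qed

lemma distinct_labs: "distinct labs"
  by (simp add: labs_def)

instance lab :: finite
  by standard (metis set_labs List.finite_set)

lemma card_lab: "card (UNIV :: lab set) = 16"
  using distinct_card[OF distinct_labs] unfolding set_labs by (simp add: labs_def)

section \<open>Search for the third color\<close>

text \<open>One of the two faces of colors 1, 2 in the standard labelling; see
  \<open>Collect_low\<close>.\<close>

fun low :: "lab \<Rightarrow> bool" where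
  "low L1 = True" | "low L2 = True" | "low L3 = True" | "low L4 = True"
| "low L5 = True" | "low L6 = True" | "low L7 = True" | "low L8 = True"
| "low L9 = False" | "low L10 = False" | "low L11 = False" | "low L12 = False"
| "low L13 = False" | "low L14 = False" | "low L15 = False" | "low L16 = False"

text \<open>The walk alternating between \<open>p\<close> and the part of color 3 known from
  \<open>es\<close>. It stops before an unknown edge, or after \<open>2 * n + 1\<close> vertices;
  for \<open>n = 4\<close> a closed octagon is run through once and its start repeated.\<close>

fun trail :: "nat \<Rightarrow> ('v \<Rightarrow> 'v) \<Rightarrow> ('v \<times> 'v) list \<Rightarrow> 'v \<Rightarrow> 'v list" where
  "trail 0 p es x = [x]"
| "trail (Suc n) p es x = x # p x # (case map_of es (p x) of None \<Rightarrow> [] | Some y \<Rightarrow> trail n p es y)"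

text \<open>
  The counters \<open>i\<close> and \<open>j\<close> say how many of the vertices 1 to 8 and 9 to 16 may still come.
\<close>

fun fits :: "lab \<Rightarrow> lab list \<Rightarrow> nat \<Rightarrow> nat \<Rightarrow> lab list \<Rightarrow> bool" where
  "fits x0 seen i j [] = True"
| "fits x0 seen i j (x # xs) =
    (if mem x seen then (if x = x0 then i = 0 \<and> j = 0 else False)
     else if low x then (case i of 0 \<Rightarrow> False | Suc i' \<Rightarrow> fits x0 (x # seen) i' j xs)
     else (case j of 0 \<Rightarrow> False | Suc j' \<Rightarrow> fits x0 (x # seen) i j' xs))"

text \<open>
  The first trail only serves to find an end of the path through \<open>x\<close>.
\<close>

definition octagonal :: "(lab \<Rightarrow> lab) \<Rightarrow> (lab \<times> lab) list \<Rightarrow> lab \<Rightarrow> bool" where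
  "octagonal p es x = (let y = last (trail 4 p es x) in fits y [] 4 4 (trail 4 p es y))"

definition free :: "('v \<times> 'v) list \<Rightarrow> 'v \<Rightarrow> bool" where
  "free es x = (case map_of es x of None \<Rightarrow> True | Some y \<Rightarrow> False)"

text \<open>
  Continuing an open face keeps the number of branches small; any other choice would be sound.
\<close>

definition next_end :: "(lab \<times> lab) list \<Rightarrow> lab option" where
  "next_end es =
    (let e = last (trail 4 std_color1 es L2)
     in if free es e then Some e
        else case List.find (free es) labs of None \<Rightarrow> None | Some u \<Rightarrow> Some (last (trail 4 std_color1 es u)))"

text \<open>For each completed third color that the search meets, other than the two tables below,
  one of these has at least 13 cycles and so refutes a maximum of 12.\<close>

definition witness_pairings :: "(lab \<times> lab) list list" where
  "witness_pairings = [
    [(L1, L2), (L3, L8), (L4, L7), (L5, L6), (L9, L16), (L10, L15), (L11, L14), (L12, L13)],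
    [(L1, L2), (L3, L4), (L5, L6), (L7, L8), (L9, L10), (L11, L16), (L12, L15), (L13, L14)],
    [(L1, L2), (L3, L4), (L5, L6), (L7, L8), (L9, L12), (L10, L11), (L13, L16), (L14, L15)],
    [(L1, L2), (L3, L4), (L5, L6), (L7, L8), (L9, L16), (L10, L15), (L11, L14), (L12, L13)],
    [(L1, L2), (L3, L4), (L5, L6), (L7, L8), (L9, L14), (L10, L13), (L11, L12), (L15, L16)],
    [(L1, L2), (L3, L4), (L5, L8), (L6, L7), (L9, L12), (L10, L11), (L13, L16), (L14, L15)],
    [(L1, L2), (L3, L4), (L5, L6), (L7, L8), (L9, L13), (L10, L14), (L11, L15), (L12, L16)],
    [(L1, L2), (L3, L4), (L5, L8), (L6, L7), (L9, L10), (L11, L12), (L13, L14), (L15, L16)],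
    [(L1, L2), (L3, L16), (L4, L15), (L5, L14), (L6, L13), (L7, L12), (L8, L11), (L9, L10)],
    [(L1, L2), (L3, L6), (L4, L5), (L7, L8), (L9, L10), (L11, L12), (L13, L14), (L15, L16)],
    [(L1, L2), (L3, L8), (L4, L7), (L5, L6), (L9, L12), (L10, L11), (L13, L16), (L14, L15)],
    [(L1, L2), (L3, L6), (L4, L5), (L7, L8), (L9, L10), (L11, L14), (L12, L13), (L15, L16)],
    [(L1, L2), (L3, L8), (L4, L7), (L5, L6), (L9, L10), (L11, L12), (L13, L14), (L15, L16)],
    [(L1, L2), (L3, L11), (L4, L12), (L5, L13), (L6, L14), (L7, L15), (L8, L16), (L9, L10)],
    [(L1, L2), (L3, L14), (L4, L13), (L5, L12), (L6, L11), (L7, L10), (L8, L9), (L15, L16)]]"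

text \<open>
  The image of \<open>ex_color3\<close> under \<open>flip\<close> below.
\<close>

fun alt_color3 :: "lab \<Rightarrow> lab" where
  "alt_color3 L1 = L7" | "alt_color3 L2 = L9" | "alt_color3 L3 = L5" | "alt_color3 L4 = L11"
| "alt_color3 L5 = L3" | "alt_color3 L6 = L13" | "alt_color3 L7 = L1" | "alt_color3 L8 = L15"
| "alt_color3 L9 = L2" | "alt_color3 L10 = L16" | "alt_color3 L11 = L4" | "alt_color3 L12 = L14"
| "alt_color3 L13 = L6" | "alt_color3 L14 = L12" | "alt_color3 L15 = L8" | "alt_color3 L16 = L10"

fun any_witness :: "('v \<times> 'v) list list \<Rightarrow> 'v node list \<Rightarrow> bool" where
  "any_witness [] st = False"
| "any_witness (w # ws) st = (if 13 \<le> gain w st then True else any_witness ws st)"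

definition leaf_ok :: "(lab \<times> lab) list \<Rightarrow> bool" where
  "leaf_ok es =
    (if any_witness witness_pairings (state std_color1 std_color2 (\<lambda>x. the (map_of es x)) labs) then True
     else if list_all (\<lambda>x. map_of es x = Some (ex_color3 x)) labs then True
     else list_all (\<lambda>x. map_of es x = Some (alt_color3 x)) labs)"

text \<open>Branches over all color 3 partners \<open>y\<close> of the chosen end. A partner whose
  recorded mate is \<open>x\<close> itself also passes, so that soundness follows from
  \<open>agrees\<close> without an invariant that \<open>x\<close> is free.\<close>

fun search :: "nat \<Rightarrow> (lab \<times> lab) list \<Rightarrow> bool" where
  "search 0 es = False"
| "search (Suc n) es =
    (case next_end es of None \<Rightarrow> leaf_ok es
     | Some x \<Rightarrow> list_all (\<lambda>y.
         if y = x then True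
         else if (case map_of es y of None \<Rightarrow> True | Some z \<Rightarrow> z = x) then
           let es' = (x, y) # (y, x) # es
           in if octagonal std_color1 es' x then if octagonal std_color2 es' x then search n es' else True else True
         else True) labs)"

text \<open>Color 3 has eight edges and one is given: seven levels add the others and the eighth
  evaluates the leaf.\<close>

lemma search_ok: "search 8 [(L2, L9), (L9, L2)]"
  by code_simp

section \<open>Soundness of the search\<close>

definition agrees :: "('v \<times> 'v) list \<Rightarrow> ('v \<Rightarrow> 'v) \<Rightarrow> bool" where
  "agrees es c \<longleftrightarrow> (\<forall>(x, y)\<in>set es. c x = y)"

lemma agrees_map_of: "agrees es c \<Longrightarrow> map_of es x = Some y \<Longrightarrow> c x = y"
  by (auto simp: agrees_def dest: map_of_SomeD)

text \<open>Known edges are edges of \<open>c\<close>, so the trail is an initial segment of the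
  true walk, whichever completion \<open>c\<close> is meant.\<close>

lemma trail_eq:
  assumes "agrees es c"
  shows "\<exists>k \<le> Suc (2 * n). trail n p es x = map (alternate p c x) [0..<k]"
proof (induction n arbitrary: x)
  case 0
  show ?case by (intro exI[where x = 1]) simp
next
  case (Suc n)
  have two: "map (alternate p c x) [0..<Suc (Suc k)] = x # p x # map (alternate p c (c (p x))) [0..<k]" for k
    by (simp add: alternate.simps(2) map_upt_Suc del: upt_Suc)
  show ?case
  proof (cases "map_of es (p x)")
    case None
    then have "trail (Suc n) p es x = map (alternate p c x) [0..<Suc (Suc 0)]" unfolding two by simp
    then show ?thesis by (intro exI[where x = "Suc (Suc 0)"] conjI) (simp_all del: trail.simps upt_Suc)
  next
    case (Some y)
    then have y: "y = c (p x)" using agrees_map_of[OF assms] by simp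
    obtain k where "k \<le> Suc (2 * n)" "trail n p es y = map (alternate p c y) [0..<k]" using Suc by blast
    then have "trail (Suc n) p es x = map (alternate p c x) [0..<Suc (Suc k)]" unfolding two using Some y by simp
    then show ?thesis using \<open>k \<le> Suc (2 * n)\<close>
      by (intro exI[where x = "Suc (Suc k)"] conjI) (simp_all del: trail.simps upt_Suc)
  qed
qed

text \<open>For a trail that breaks off at an unknown edge: it is only part of a face, so the
  counters need not be used up.\<close>

lemma fits_open:
  assumes "distinct xs" "set xs \<inter> set seen = {}"
    "length (filter low xs) \<le> i" "length (filter (\<lambda>x. \<not> low x) xs) \<le> j"
  shows "fits x0 seen i j xs"
  using assms
proof (induction xs arbitrary: seen i j)
  case (Cons x xs)
  then show ?case by (cases "low x"; cases i; cases j) (auto simp: mem_iff)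
qed simp

text \<open>For a trail that has come back to its start: the face is complete, so both counters must
  be exactly 0 when \<open>x0\<close> is met again.\<close>

lemma fits_closed:
  assumes "distinct xs" "set xs \<inter> set seen = {}" "x0 \<in> set seen \<union> set xs"
    "length (filter low xs) = i" "length (filter (\<lambda>x. \<not> low x) xs) = j"
  shows "fits x0 seen i j (xs @ [x0])"
  using assms
proof (induction xs arbitrary: seen i j)
  case (Cons x xs)
  then show ?case by (cases "low x"; cases i; cases j) (auto simp: mem_iff)
qed (simp add: mem_iff)

text \<open>What the hypotheses on lengths and shared edges say about faces of colors
  \<open>p\<close>, \<open>c\<close>: four of the eight vertices are \<open>low\<close>, two shared
  edges having four ends.\<close>

definition balanced :: "(lab \<Rightarrow> lab) \<Rightarrow> (lab \<Rightarrow> lab) \<Rightarrow> bool" where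
  "balanced p c \<longleftrightarrow> (\<forall>x. card (component p c x) = 8 \<and> card (component p c x \<inter> Collect low) = 4)"

lemma fits_trail:
  assumes p: "invol_on UNIV p" and c: "invol_on UNIV c" and bal: "balanced p c" and es: "agrees es c"
  shows "fits x [] 4 4 (trail 4 p es x)"
proof -
  let ?s = "alternate p c x"
  obtain k where k: "k \<le> 9" and tr: "trail 4 p es x = map ?s [0..<k]"
    using trail_eq[OF es, of 4] by auto
  have card8: "card (component p c x) = 8" using bal by (simp add: balanced_def)
  note oct = alternate_octagon[OF p c card8]
  let ?L = "map ?s [0..<8]"
  have dist: "distinct ?L" using oct(1) by (simp add: distinct_map atLeast0LessThan)
  have set: "set ?L = component p c x" using oct(3) by (simp add: atLeast0LessThan)
  have lo: "length (filter low ?L) = 4"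
  proof -
    have "length (filter low ?L) = card (set (filter low ?L))"
      using dist by (intro distinct_card[symmetric] distinct_filter)
    also have "set (filter low ?L) = component p c x \<inter> Collect low" using set by auto
    finally show ?thesis using bal by (simp add: balanced_def)
  qed
  then have hi: "length (filter (\<lambda>x. \<not> low x) ?L) = 4"
    using sum_length_filter_compl[of low ?L] by simp
  show ?thesis
  proof (cases "k = 9")
    case True
    \<comment> \<open>Nine vertices mean that the trail has gone around the face once and ends at
      \<open>x\<close> again.\<close>
    have "[0..<9] = [0..<8] @ [8::nat]" by (simp add: upt_rec)
    then have "trail 4 p es x = ?L @ [x]" using True tr oct(2) by simp
    moreover have "x \<in> set ?L" unfolding set by (rule component_self)
    ultimately show ?thesis using fits_closed[OF dist _ _ lo hi] by simp
  next
    case False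
    \<comment> \<open>Otherwise the trail is a prefix of the eight vertices of the face and inherits
      distinctness and the bounds on both counts.\<close>
    then have "[0..<8] = [0..<k] @ [k..<8]" using k upt_add_eq_append[of 0 k "8 - k"] by simp
    then have L: "?L = trail 4 p es x @ map ?s [k..<8]" using tr by (metis map_append)
    have "distinct (trail 4 p es x)" using dist unfolding L by simp
    moreover have "length (filter low (trail 4 p es x)) \<le> 4" using lo unfolding L by simp
    moreover have "length (filter (\<lambda>x. \<not> low x) (trail 4 p es x)) \<le> 4" using hi unfolding L by simp
    ultimately show ?thesis by (intro fits_open) simp_all
  qed
qed

lemma octagonal_sound:
  assumes "invol_on UNIV p" "invol_on UNIV c" "balanced p c" "agrees es c"
  shows "octagonal p es x"
  unfolding octagonal_def Let_def by (rule fits_trail[OF assms])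

lemma any_witness_iff: "any_witness ws st \<longleftrightarrow> (\<exists>w\<in>set ws. 13 \<le> gain w st)"
  by (induction ws) auto

lemma list_all_labs: "list_all Q labs \<longleftrightarrow> (\<forall>x. Q x)"
  by (simp add: list_all_iff set_labs)

lemma leaf_ok_sound:
  assumes "leaf_ok es" "agrees es c" "\<And>x. map_of es x \<noteq> None"
  shows "c = ex_color3 \<or> c = alt_color3 \<or> (\<exists>w\<in>set witness_pairings. 13 \<le> gain w (state std_color1 std_color2 c labs))"
proof -
  have mo: "map_of es x = Some (c x)" for x
    using assms(3)[of x] agrees_map_of[OF assms(2), of x] by auto
  then have "(\<lambda>x. the (map_of es x)) = c" by auto
  then show ?thesis
    using assms(1) unfolding leaf_ok_def by (auto simp: mo any_witness_iff list_all_labs split: if_splits)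
qed

text \<open>The true color \<open>c\<close> selects one branch at each level and is never pruned, so
  it arrives at a leaf.\<close>

lemma search_sound:
  assumes "search n es" "agrees es c" and c: "invol_on UNIV c"
    and std: "invol_on UNIV std_color1" "invol_on UNIV std_color2" and bal: "balanced std_color1 c" "balanced std_color2 c"
  shows "c = ex_color3 \<or> c = alt_color3 \<or> (\<exists>w\<in>set witness_pairings. 13 \<le> gain w (state std_color1 std_color2 c labs))"
  using assms(1,2)
proof (induction n arbitrary: es)
  case (Suc n)
  show ?case
  proof (cases "next_end es")
    case None
    \<comment> \<open>\<open>next_end\<close> gives no vertex only if none is free, so
      \<open>es\<close> determines \<open>c\<close> completely.\<close>
    then have "List.find (free es) labs = None"
      by (auto simp: next_end_def Let_def split: if_splits option.splits)
    then have "map_of es x \<noteq> None" for x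
      by (auto simp: find_None_iff set_labs free_def split: option.splits)
    then show ?thesis using leaf_ok_sound Suc.prems None by simp
  next
    case (Some x)
    \<comment> \<open>The branch to follow is \<open>y = c x\<close>: since \<open>c\<close> is a
      balanced involution agreeing with \<open>es\<close>, it passes all tests.\<close>
    let ?es = "(x, c x) # (c x, x) # es"
    have cx: "c x \<noteq> x" "c (c x) = x" using invol_onD[OF c] by auto
    have agr: "agrees ?es c" using Suc.prems(2) cx by (simp add: agrees_def)
    have "case map_of es (c x) of None \<Rightarrow> True | Some z \<Rightarrow> z = x"
      using agrees_map_of[OF Suc.prems(2), of "c x"] cx by (auto split: option.splits)
    moreover have "octagonal std_color1 ?es x" "octagonal std_color2 ?es x"
      using octagonal_sound[OF _ c _ agr] std bal by blast+
    ultimately have "search n ?es"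
      using Suc.prems(1)[unfolded search.simps Some option.case list_all_labs, THEN spec, of "c x"] cx(1)
      by (simp add: Let_def)
    then show ?thesis using Suc.IH agr by blast
  qed
qed simp

section \<open>The graph \<open>G_ex\<close> and its uniqueness\<close>

text \<open>The initial exclusion lists are empty, so this covers every pairing; 60 is enough fuel
  for the depth of the branching.\<close>

lemma bounded_ex: "bounded 60 13 (state std_color1 std_color2 ex_color3 labs)"
  by code_simp

definition ex_coloring :: "nat \<Rightarrow> lab \<Rightarrow> lab" where
  "ex_coloring i = (if i = 1 then std_color1 else if i = 2 then std_color2 else ex_color3)"

lemma invol_std_color1: "invol_on UNIV std_color1"
  unfolding invol_on_def by (intro ballI, rename_tac x, case_tac x) simp_all

lemma invol_std_color2: "invol_on UNIV std_color2"
  unfolding invol_on_def by (intro ballI, rename_tac x, case_tac x) simp_all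

lemma invol_ex_color3: "invol_on UNIV ex_color3"
  unfolding invol_on_def by (intro ballI, rename_tac x, case_tac x) simp_all

lemma invol_ex_coloring: "invol_on UNIV (ex_coloring i)"
  by (simp add: ex_coloring_def invol_std_color1 invol_std_color2 invol_ex_color3)

text \<open>The first eight vertices of \<open>alternate\<close>, unrolled with shared intermediate
  vertices for evaluation.\<close>

definition octagon :: "('v \<Rightarrow> 'v) \<Rightarrow> ('v \<Rightarrow> 'v) \<Rightarrow> 'v \<Rightarrow> 'v list" where
  "octagon p q x =
     (let x1 = p x; x2 = q x1; x3 = p x2; x4 = q x3; x5 = p x4; x6 = q x5; x7 = p x6
      in [x, x1, x2, x3, x4, x5, x6, x7])"

lemma octagon_eq_alternate: "octagon p q x = map (alternate p q x) [0..<8]"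
  by (simp add: octagon_def Let_def upt_rec alternate.simps(2) eval_nat_numeral)

lemma component_eq_octagon:
  assumes "invol_on UNIV p" "invol_on UNIV q" "q (last (octagon p q x)) = x"
  shows "component p q x = set (octagon p q x)"
proof -
  have "alternate p q x (2 * 4) = x"
    using assms(3) by (simp add: octagon_def Let_def alternate.simps(2) eval_nat_numeral)
  then have "component p q x = alternate p q x ` {..<2 * 4}" by (rule component_eq_alternate[OF assms(1,2)]) simp
  then show ?thesis unfolding octagon_eq_alternate by (simp add: atLeast0LessThan)
qed

definition closes :: "(lab \<Rightarrow> lab) \<Rightarrow> (lab \<Rightarrow> lab) \<Rightarrow> bool" where
  "closes p q \<longleftrightarrow> list_all (\<lambda>x. q (last (octagon p q x)) = x \<and> distinct (octagon p q x)) labs"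

definition common :: "(lab \<Rightarrow> lab) \<Rightarrow> (lab \<Rightarrow> lab) \<Rightarrow> (lab \<Rightarrow> lab) \<Rightarrow> bool" where
  "common p q r \<longleftrightarrow> list_all (\<lambda>x. list_all (\<lambda>y.
     length (filter (\<lambda>z. mem z (octagon p r y)) (octagon p q x)) = 4) labs) labs"

lemma closes_ex:
  "closes std_color1 std_color2" "closes std_color2 std_color1" "closes std_color1 ex_color3" "closes ex_color3 std_color1" "closes std_color2 ex_color3" "closes ex_color3 std_color2"
  by code_simp+

lemma common_ex: "common std_color1 std_color2 ex_color3" "common std_color2 std_color1 ex_color3" "common ex_color3 std_color1 std_color2"
  by code_simp+

lemma closesD:
  assumes "invol_on UNIV p" "invol_on UNIV q" "closes p q"
  shows "component p q x = set (octagon p q x)" "distinct (octagon p q x)" "card (component p q x) = 8"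
proof -
  show *: "component p q x = set (octagon p q x)" "distinct (octagon p q x)"
    using assms(3) component_eq_octagon[OF assms(1,2)] by (auto simp: closes_def list_all_labs)
  show "card (component p q x) = 8"
    unfolding * using distinct_card[OF *(2)] by (simp add: octagon_def Let_def)
qed

lemma component_ex:
  assumes "i \<in> {1,2,3}" "j \<in> {1,2,3}" "i \<noteq> j"
  shows "component (ex_coloring i) (ex_coloring j) x = set (octagon (ex_coloring i) (ex_coloring j) x)"
    "distinct (octagon (ex_coloring i) (ex_coloring j) x)"
    "card (component (ex_coloring i) (ex_coloring j) x) = 8"
proof -
  have "closes (ex_coloring i) (ex_coloring j)"
    using assms closes_ex by (auto simp: ex_coloring_def)
  from closesD[OF invol_ex_coloring invol_ex_coloring this]
  show "component (ex_coloring i) (ex_coloring j) x = set (octagon (ex_coloring i) (ex_coloring j) x)"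
    "distinct (octagon (ex_coloring i) (ex_coloring j) x)"
    "card (component (ex_coloring i) (ex_coloring j) x) = 8" by blast+
qed

lemma card_component_Int_ex:
  assumes ijk: "i \<in> {1,2,3}" "j \<in> {1,2,3}" "k \<in> {1,2,3}" "i \<noteq> j" "i \<noteq> k" "j \<noteq> k"
  shows "card (component (ex_coloring i) (ex_coloring j) x \<inter> component (ex_coloring i) (ex_coloring k) y) = 4"
proof -
  have main: "card (component (ex_coloring i) (ex_coloring j) x \<inter> component (ex_coloring i) (ex_coloring k) y) = 4"
    if "common (ex_coloring i) (ex_coloring j) (ex_coloring k)"
      and "i \<in> {1,2,3}" "j \<in> {1,2,3}" "k \<in> {1,2,3}" "i \<noteq> j" "i \<noteq> k" for i j k x y
  proof -
    let ?C = "octagon (ex_coloring i) (ex_coloring j) x" and ?D = "octagon (ex_coloring i) (ex_coloring k) y"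
    have "card (set ?C \<inter> set ?D) = length (filter (\<lambda>z. mem z ?D) ?C)"
      using distinct_card[OF distinct_filter[OF component_ex(2)[OF that(2,3,5), of x]], of "\<lambda>z. mem z ?D"]
      by (simp add: mem_iff Int_def)
    then show ?thesis
      using that(1) component_ex(1)[OF that(2,3,5)] component_ex(1)[OF that(2,4,6)]
      by (simp add: common_def list_all_labs)
  qed
  \<comment> \<open>For each \<open>i\<close>, only one order of the other two colors was evaluated;
    the other order follows by commuting the intersection.\<close>
  have "common (ex_coloring i) (ex_coloring j) (ex_coloring k) \<or> common (ex_coloring i) (ex_coloring k) (ex_coloring j)"
    using ijk common_ex by (auto simp: ex_coloring_def)
  then show ?thesis
  proof
    assume "common (ex_coloring i) (ex_coloring j) (ex_coloring k)"
    then show ?thesis using main ijk by blast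
  next
    assume "common (ex_coloring i) (ex_coloring k) (ex_coloring j)"
    then have "card (component (ex_coloring i) (ex_coloring k) y \<inter> component (ex_coloring i) (ex_coloring j) x) = 4"
      using main ijk by blast
    then show ?thesis by (simp add: Int_commute)
  qed
qed

fun label_nat :: "lab \<Rightarrow> nat" where
  "label_nat L1 = 1" | "label_nat L2 = 2" | "label_nat L3 = 3" | "label_nat L4 = 4"
| "label_nat L5 = 5" | "label_nat L6 = 6" | "label_nat L7 = 7" | "label_nat L8 = 8"
| "label_nat L9 = 9" | "label_nat L10 = 10" | "label_nat L11 = 11" | "label_nat L12 = 12"
| "label_nat L13 = 13" | "label_nat L14 = 14" | "label_nat L15 = 15" | "label_nat L16 = 16"

lemma coded_G_ex: "coded G_ex label_nat ex_coloring"
  unfolding coded_def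
proof (intro conjI ballI)
  have labs: "UNIV = set labs" by (simp add: set_labs)
  \<comment> \<open>Comparison with an interval list yields the range and the injectivity at
    once.\<close>
  have map: "map label_nat labs = [1..<17]"
    by (simp add: labs_def upt_rec)
  have "label_nat ` set labs = {1..<17}"
    unfolding set_map[symmetric] map by (rule set_upt)
  moreover have "inj_on label_nat (set labs)"
    using distinct_upt[of 1 17] unfolding map[symmetric] distinct_map by (rule conjunct2)
  moreover have "{1..<17} = {1..16::nat}" by auto
  ultimately show "bij_betw label_nat UNIV (verts G_ex)"
    by (simp add: bij_betw_def labs G_ex_def)
  fix i :: nat assume i: "i \<in> {1,2,3}"
  show "invol_on UNIV (ex_coloring i)" by (rule invol_ex_coloring)
  show "edges G_ex i = range (\<lambda>x. {label_nat x, label_nat (ex_coloring i x)})"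
    unfolding labs using i by (auto simp: G_ex_def ex_coloring_def labs_def insert_commute)
qed

section \<open>The face conditions for \<open>G_ex\<close>\<close>

lemma faces_commute: "faces G i j = faces G j i"
  by (simp add: faces_def adjacency_def Un_commute)

lemma face_edges_commute: "face_edges G i j C = face_edges G j i C"
  by (auto simp: face_edges_def)

lemma regular_G_ex: "regular_3_edge_colored 8 G_ex"
  by (rule regular_coded[OF coded_G_ex]) (simp add: card_lab)

lemma two_faces_G_ex: "two_faces_per_color_pair G_ex"
  unfolding two_faces_per_color_pair_def
proof (intro ballI impI)
  fix i j :: nat assume ij: "i \<in> {1,2,3}" "j \<in> {1,2,3}" "i \<noteq> j"
  let ?p = "ex_coloring i" and ?q = "ex_coloring j"
  \<comment> \<open>Sixteen vertices are divided into components of eight.\<close>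
  have "card (UNIV :: lab set) = (\<Sum>C\<in>UNIV // (link UNIV ?p ?q)\<^sup>*. card (UNIV \<inter> C))"
    by (rule card_eq_sum_classes) (simp_all add: invol_ex_coloring)
  also have "\<dots> = (\<Sum>C\<in>UNIV // (link UNIV ?p ?q)\<^sup>*. 8)"
    using component_ex(3)[OF ij] by (intro sum.cong) (auto simp: quotient_def component_def)
  finally have "num_components UNIV ?p ?q = 2" by (simp add: num_components_def card_lab)
  then show "card (faces G_ex i j) = 2"
    using faces_coded[OF coded_G_ex ij(1,2)] card_range_component[OF codedD(1)[OF coded_G_ex]] by simp
qed

lemma length_8_G_ex: "all_faces_length_8 G_ex"
  unfolding all_faces_length_8_def
proof (intro ballI impI)
  fix i j :: nat and C assume ij: "i \<in> {1,2,3}" "j \<in> {1,2,3}" "i \<noteq> j" and C: "C \<in> faces G_ex i j"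
  obtain x where "C = label_nat ` component (ex_coloring i) (ex_coloring j) x"
    using C faces_coded[OF coded_G_ex ij(1,2)] by auto
  then show "face_length G_ex i j C = 8"
    using face_length_coded[OF coded_G_ex ij] component_ex(3)[OF ij] by simp
qed

lemma share_two_G_ex: "faces_share_two_edges G_ex"
proof -
  have main: "card (face_edges G_ex i j C \<inter> face_edges G_ex i k D) = 2"
    if ijk: "i \<in> {1,2,3}" "j \<in> {1,2,3}" "k \<in> {1,2,3}" "i \<noteq> j" "i \<noteq> k" "j \<noteq> k"
      and C: "C \<in> faces G_ex i j" and D: "D \<in> faces G_ex i k" for i j k C D
  proof -
    obtain x where x: "C = label_nat ` component (ex_coloring i) (ex_coloring j) x"
      using C faces_coded[OF coded_G_ex ijk(1,2)] by auto
    obtain y where y: "D = label_nat ` component (ex_coloring i) (ex_coloring k) y"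
      using D faces_coded[OF coded_G_ex ijk(1,3)] by auto
    show ?thesis
      using shared_edges_coded[OF coded_G_ex ijk, of x y] card_component_Int_ex[OF ijk, of x y] x y by simp
  qed
  show ?thesis
    unfolding faces_share_two_edges_def
  proof (intro ballI impI)
    fix i j k l :: nat and C D
    assume i: "i \<in> {1,2,3}" and j: "j \<in> {1,2,3}" and k: "k \<in> {1,2,3}" and l: "l \<in> {1,2,3}"
      and ne: "i \<noteq> j" "k \<noteq> l" and one: "card ({i, j} \<inter> {k, l}) = 1"
      and C: "C \<in> faces G_ex i j" and D: "D \<in> faces G_ex k l"
    have C': "C \<in> faces G_ex j i" and D': "D \<in> faces G_ex l k"
      unfolding faces_commute[of _ j i] faces_commute[of _ l k] using C D by blast+
    \<comment> \<open>The common color can stand in either place of either pair; commuting the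
      colors of a face brings it to the front, where \<open>main\<close> applies.\<close>
    consider "i = k" "j \<noteq> l" | "i = l" "j \<noteq> k" | "j = k" "i \<noteq> l" | "j = l" "i \<noteq> k"
    proof -
      obtain z where z: "{i, j} \<inter> {k, l} = {z}" using one by (auto simp: card_1_singleton_iff)
      have "i = k \<or> i = l \<Longrightarrow> i = z" "j = k \<or> j = l \<Longrightarrow> j = z" "z = i \<or> z = j" "z = k \<or> z = l"
        using z by blast+
      then show ?thesis using ne that by metis
    qed
    then show "card (face_edges G_ex i j C \<inter> face_edges G_ex k l D) = 2"
    proof cases
      case 1
      then show ?thesis using main[OF i j l ne(1) _ _ C] D ne by simp
    next
      case 2
      then show ?thesis
        using main[OF i j k ne(1) _ _ C] D' ne by (subst face_edges_commute[of _ k l]) simp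
    next
      case 3
      then show ?thesis
        using main[OF j i l ne(1)[symmetric] _ _ C'] D ne by (subst face_edges_commute[of _ i j]) simp
    next
      case 4
      then show ?thesis
        using main[OF j i k ne(1)[symmetric] _ _ C'] D' ne
        by (subst face_edges_commute[of _ i j], subst face_edges_commute[of _ k l]) simp
    qed
  qed
qed

section \<open>Lower bounds from explicit pairings, and the maximum for \<open>G_ex\<close>\<close>

definition pair_map :: "('v \<times> 'v) list \<Rightarrow> 'v \<Rightarrow> 'v" where
  "pair_map w x = the (map_of (w @ map (\<lambda>(u, v). (v, u)) w) x)"

definition pairs_ok :: "(lab \<times> lab) list \<Rightarrow> bool" where
  "pairs_ok w \<longleftrightarrow> list_all (\<lambda>x. pair_map w x \<noteq> x \<and> pair_map w (pair_map w x) = x) labs \<and>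
     list_all (\<lambda>(u, v). pair_map w u = v) w"

lemma gain_le_F_max:
  assumes G: "coded G \<phi> P" and ok: "pairs_ok w"
  shows "gain w (state (P 1) (P 2) (P 3) labs) \<le> F_max G"
proof -
  have m: "invol_on UNIV (pair_map w)"
    using ok by (auto simp: pairs_ok_def list_all_labs invol_on_def)
  have "represents (state (P 1) (P 2) (P 3) labs) UNIV (pair_map w) (P 1) (P 2) (P 3)"
    using represents_state[OF distinct_labs] by (simp add: set_labs)
  then have "gain w (state (P 1) (P 2) (P 3) labs) \<le> faces_with UNIV (pair_map w) (P 1) (P 2) (P 3)"
    by (rule gain_le) (use ok m codedD(3)[OF G] in \<open>auto simp: pairs_ok_def list_all_iff\<close>)
  also have "\<dots> \<le> F_max G"
    unfolding F_max_coded(1)[OF G] by (rule Max_ge[OF F_max_coded(2)[OF G]]) (use m in blast)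
  finally show ?thesis .
qed

lemma pairs_ok_witness_pairings: "list_all pairs_ok witness_pairings"
  by code_simp

text \<open>Color 1 itself is an optimal pairing: its eight edges are doubled, and it forms two
  cycles with each other color, in total 8 + 2 + 2 = 12.\<close>

definition std_color1_pairs :: "(lab \<times> lab) list" where
  "std_color1_pairs = [(L1, L2), (L3, L4), (L5, L6), (L7, L8), (L9, L10), (L11, L12), (L13, L14), (L15, L16)]"

lemma std_color1_pairs_ok: "pairs_ok std_color1_pairs"
  by code_simp

lemma gain_std_color1_pairs: "gain std_color1_pairs (state std_color1 std_color2 ex_color3 labs) = 12"
  by code_simp

lemma F_max_G_ex: "F_max G_ex = 12"
proof (rule antisym)
  have "faces_with UNIV m std_color1 std_color2 ex_color3 \<le> 12" if "invol_on UNIV m" for m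
  proof -
    have "represents (state std_color1 std_color2 ex_color3 labs) UNIV m std_color1 std_color2 ex_color3"
      using represents_state[OF distinct_labs] by (simp add: set_labs)
    from bounded_sound[OF bounded_ex this _ that invol_std_color1 invol_std_color2 invol_ex_color3]
    show ?thesis by simp
  qed
  then show "F_max G_ex \<le> 12"
    unfolding F_max_coded(1)[OF coded_G_ex]
    using F_max_coded(2)[OF coded_G_ex] invol_std_color1 by (subst Max_le_iff) (auto simp: ex_coloring_def)
  show "12 \<le> F_max G_ex"
    using gain_le_F_max[OF coded_G_ex std_color1_pairs_ok] gain_std_color1_pairs by (simp add: ex_coloring_def)
qed

text \<open>The number of steps from \<open>L2\<close>, respectively \<open>L9\<close>, along the
  face of colors 1, 2, the first step having color 1.\<close>

fun position :: "lab \<Rightarrow> nat" where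
  "position L1 = 1" | "position L2 = 0" | "position L3 = 7" | "position L4 = 6"
| "position L5 = 5" | "position L6 = 4" | "position L7 = 3" | "position L8 = 2"
| "position L9 = 0" | "position L10 = 1" | "position L11 = 2" | "position L12 = 3"
| "position L13 = 4" | "position L14 = 5" | "position L15 = 6" | "position L16 = 7"

lemma position_less: "position l < 8"
  by (cases l) simp_all

lemma position_low_inj: "position l = position l' \<Longrightarrow> low l = low l' \<Longrightarrow> l = l'"
  by (cases l; cases l') simp_all

lemma obtain_standard_labelling:
  fixes a b c :: "lab \<Rightarrow> lab"
  assumes a: "invol_on UNIV a" and b: "invol_on UNIV b"
    and ab: "\<And>x. card (component a b x) = 8" and ac: "\<And>x. card (component a c x) = 8"
    and abc: "\<And>x y. card (component a b x \<inter> component a c y) = 4"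
  obtains \<sigma> where "bij \<sigma>" "\<And>l. a (\<sigma> l) = \<sigma> (std_color1 l)" "\<And>l. b (\<sigma> l) = \<sigma> (std_color2 l)" "c (\<sigma> L2) = \<sigma> L9"
proof -
  let ?C = "component a b L1"
  have "\<exists>x\<in>?C. c x \<notin> ?C"
  proof (rule ccontr)
    assume "\<not> (\<exists>x\<in>?C. c x \<notin> ?C)"
    then have "a z \<in> ?C \<and> c z \<in> ?C" if "z \<in> ?C" for z using that component_step(1)[OF that] by blast
    then have "component a c L1 \<subseteq> ?C" by (rule component_subset[OF component_self])
    then have "?C \<inter> component a c L1 = component a c L1" by blast
    \<comment> \<open>All eight vertices of a face of colors 1, 3 would be common to both faces,
      instead of four.\<close>
    then show False using abc[of L1 L1] ac[of L1] by simp
  qed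
  then obtain x where x: "x \<in> ?C" "c x \<notin> ?C" by blast
  have out: "c x \<notin> component a b x"
    using x rtrancl_Image_eq[OF sym_link[OF a b], of L1 x] unfolding component_def by auto
  define y where "y = c x"
  \<comment> \<open>The crossing edge from \<open>x\<close> to \<open>y\<close> is to become the
    edge from \<open>L2\<close> to \<open>L9\<close>; the labels then follow both faces from its
    ends, first along \<open>a\<close>.\<close>
  define \<sigma> where "\<sigma> l = alternate a b (if low l then x else y) (position l)" for l
  have inj: "inj \<sigma>"
  proof (rule injI)
    fix l l' assume eq: "\<sigma> l = \<sigma> l'"
    have "\<sigma> l \<in> component a b (if low l then x else y)" "\<sigma> l' \<in> component a b (if low l' then x else y)"
      unfolding \<sigma>_def by (rule alternate_in_component)+
    then have low: "low l = low l'"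
      using eq component_disjoint[OF a b out] unfolding y_def by (auto split: if_splits)
    have "position l = position l'"
      using alternate_octagon(1)[OF a b ab, of "if low l then x else y"] eq low position_less
      unfolding \<sigma>_def by (simp add: inj_on_eq_iff)
    then show "l = l'" using low by (rule position_low_inj)
  qed
  have "bij \<sigma>" using inj by (simp add: bij_def finite_UNIV_inj_surj)
  moreover have aa: "a (a z) = z" and bb: "b (b z) = z" for z
    using invol_onD(3)[OF a] invol_onD(3)[OF b] by auto
  have zs: "alternate a b z (Suc 0) = a z" "alternate a b z 2 = b (alternate a b z (Suc 0))" "alternate a b z 3 = a (alternate a b z 2)"
     "alternate a b z 4 = b (alternate a b z 3)" "alternate a b z 5 = a (alternate a b z 4)" "alternate a b z 6 = b (alternate a b z 5)"
     "alternate a b z 7 = a (alternate a b z 6)" "b (alternate a b z 7) = z" "b z = alternate a b z 7" for z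
  proof -
    show "alternate a b z (Suc 0) = a z" using alternate_Suc[of a b z 0] by simp
    show "alternate a b z 2 = b (alternate a b z (Suc 0))" using alternate_Suc[of a b z "Suc 0"] by (simp add: numeral_2_eq_2)
    show "alternate a b z 3 = a (alternate a b z 2)"
      "alternate a b z 4 = b (alternate a b z 3)" "alternate a b z 5 = a (alternate a b z 4)"
      "alternate a b z 6 = b (alternate a b z 5)" "alternate a b z 7 = a (alternate a b z 6)"
      using alternate_Suc[of a b z 2] alternate_Suc[of a b z 3]
        alternate_Suc[of a b z 4] alternate_Suc[of a b z 5] alternate_Suc[of a b z 6] by simp_all
    show c: "b (alternate a b z 7) = z"
      using alternate_Suc[of a b z 7] alternate_octagon(2)[OF a b ab, of z] by simp
    show "b z = alternate a b z 7" using bb[of "alternate a b z 7"] c by simp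
  qed
  have "a (\<sigma> l) = \<sigma> (std_color1 l)" for l
    by (cases l) (simp_all add: \<sigma>_def zs(1-7) aa)
  moreover have "b (\<sigma> l) = \<sigma> (std_color2 l)" for l
    \<comment> \<open>\<open>zs(9)\<close> is instantiated at the two starting points only, as in
      general form it would rewrite every application of \<open>b\<close>.\<close>
    by (cases l) (simp_all add: \<sigma>_def zs(2,4,6,8) zs(9)[of x] zs(9)[of y] bb)
  moreover have "c (\<sigma> L2) = \<sigma> L9" by (simp add: \<sigma>_def y_def)
  ultimately show ?thesis by (rule that)
qed

text \<open>Once the crossing edge is chosen, the only freedom in the labelling is which of its ends
  is called \<open>L2\<close>. This symmetry of colors 1, 2 exchanges the ends and accounts for the
  second table.\<close>

fun flip :: "lab \<Rightarrow> lab" where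
  "flip L1 = L10" | "flip L2 = L9" | "flip L3 = L16" | "flip L4 = L15"
| "flip L5 = L14" | "flip L6 = L13" | "flip L7 = L12" | "flip L8 = L11"
| "flip L9 = L2" | "flip L10 = L1" | "flip L11 = L8" | "flip L12 = L7"
| "flip L13 = L6" | "flip L14 = L5" | "flip L15 = L4" | "flip L16 = L3"

lemma bij_flip: "bij flip"
proof (rule involuntory_imp_bij)
  show "flip (flip l) = l" for l by (cases l) simp_all
qed

lemma flip_commute: "std_color1 (flip l) = flip (std_color1 l)" "std_color2 (flip l) = flip (std_color2 l)" "alt_color3 (flip l) = flip (ex_color3 l)"
  by (cases l; simp)+

text \<open>Links the counts in \<open>balanced\<close> to the hypothesis on shared edges.\<close>

lemma Collect_low: "Collect low = component std_color1 std_color2 L1"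
proof -
  have "Collect low = set (filter low labs)" using set_labs by auto
  also have "\<dots> = set (octagon std_color1 std_color2 L1)" by (auto simp: labs_def octagon_def Let_def)
  also have "\<dots> = component std_color1 std_color2 L1" using component_ex(1)[of 1 2] by (simp add: ex_coloring_def)
  finally show ?thesis .
qed

lemma isomorphic_G_ex:
  assumes reg: "regular_3_edge_colored 8 (G :: 'a colored_graph)"
    and len: "all_faces_length_8 G" and share: "faces_share_two_edges G" and F: "F_max G = 12"
  shows "isomorphic G G_ex"
proof -
  have len8: "card (component (P i) (P j) x) = 8"
    if G: "coded G \<phi> P" and ij: "i \<in> {1,2,3}" "j \<in> {1,2,3}" "i \<noteq> j"
    for \<phi> :: "lab \<Rightarrow> 'a" and P i j x
  proof -
    have "\<phi> ` component (P i) (P j) x \<in> faces G i j" using faces_coded[OF G ij(1,2)] by simp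
    then have "face_length G i j (\<phi> ` component (P i) (P j) x) = 8"
      using len ij unfolding all_faces_length_8_def by blast
    then show ?thesis using face_length_coded[OF G ij] by simp
  qed
  have share4: "card (component (P i) (P j) x \<inter> component (P i) (P k) y) = 4"
    if G: "coded G \<phi> P" and ijk: "i \<in> {1,2,3}" "j \<in> {1,2,3}" "k \<in> {1,2,3}" "i \<noteq> j" "i \<noteq> k" "j \<noteq> k"
    for \<phi> :: "lab \<Rightarrow> 'a" and P i j k x y
  proof -
    have C: "\<phi> ` component (P i) (P j) x \<in> faces G i j" and D: "\<phi> ` component (P i) (P k) y \<in> faces G i k"
      using faces_coded[OF G] ijk by simp_all
    have single: "{i, j} \<inter> {i, k} = {i}" using ijk by auto
    have "card ({i, j} \<inter> {i, k}) = 1" unfolding single by simp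
    then have "card (face_edges G i j (\<phi> ` component (P i) (P j) x) \<inter> face_edges G i k (\<phi> ` component (P i) (P k) y)) = 2"
      using share ijk C D unfolding faces_share_two_edges_def by blast
    then show ?thesis using shared_edges_coded[OF G ijk, of x y] by simp
  qed
  obtain \<phi> :: "lab \<Rightarrow> 'a" and P where G: "coded G \<phi> P"
    by (rule obtain_coding[where 'v = lab, OF reg]) (simp_all add: card_lab)
  obtain \<sigma> where \<sigma>: "bij \<sigma>" "\<And>l. P 1 (\<sigma> l) = \<sigma> (std_color1 l)" "\<And>l. P 2 (\<sigma> l) = \<sigma> (std_color2 l)" "P 3 (\<sigma> L2) = \<sigma> L9"
    by (rule obtain_standard_labelling[of "P 1" "P 2" "P 3"])
      (simp_all add: codedD(3)[OF G] len8[OF G] share4[OF G])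
  \<comment> \<open>Color 3 in the new labels.\<close>
  define c where "c = inv \<sigma> \<circ> P 3 \<circ> \<sigma>"
  define Q where "Q i = (if i = 1 then std_color1 else if i = 2 then std_color2 else c)" for i :: nat
  have "\<sigma> (c l) = P 3 (\<sigma> l)" for l by (simp add: c_def surj_f_inv_f[OF bij_is_surj[OF \<sigma>(1)]])
  then have GQ: "coded G (\<phi> \<circ> \<sigma>) Q"
    using \<sigma>(2,3) by (intro coded_relabel[OF G \<sigma>(1)]) (auto simp: Q_def)
  have inv: "invol_on UNIV c" using codedD(3)[OF GQ, of 3] by (simp add: Q_def)
  have "c L2 = L9" using \<sigma>(4) inv_f_f[OF bij_is_inj[OF \<sigma>(1)]] by (simp add: c_def)
  then have agr: "agrees [(L2, L9), (L9, L2)] c" using invol_onD(3)[OF inv, of L2] by (simp add: agrees_def)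
  \<comment> \<open>A face of colors 1, 2 shares color 1 with the faces of colors 1, 3, and color 2
    with those of colors 2, 3.\<close>
  have bal1: "balanced std_color1 c"
    using len8[OF GQ, of 1 3] share4[OF GQ, of 1 3 2] unfolding balanced_def Collect_low by (simp add: Q_def)
  have bal2: "balanced std_color2 c"
    using len8[OF GQ, of 2 3] share4[OF GQ, of 2 3 1]
    unfolding balanced_def Collect_low component_commute[of std_color1 std_color2] by (simp add: Q_def)
  \<comment> \<open>Such a pairing would exceed the maximum of 12.\<close>
  have "\<not> 13 \<le> gain w (state std_color1 std_color2 c labs)" if "w \<in> set witness_pairings" for w
    using gain_le_F_max[OF GQ, of w] pairs_ok_witness_pairings that F by (auto simp: Q_def list_all_iff)
  then consider "c = ex_color3" | "c = alt_color3"
    using search_sound[OF search_ok agr inv invol_std_color1 invol_std_color2 bal1 bal2] by blast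
  then show ?thesis
  proof cases
    case 1
    then show ?thesis by (intro isomorphic_coded[OF GQ coded_G_ex]) (simp add: Q_def ex_coloring_def)
  next
    case 2
    then have "coded G (\<phi> \<circ> \<sigma> \<circ> flip) ex_coloring"
      by (intro coded_relabel[OF GQ bij_flip]) (auto simp: Q_def ex_coloring_def flip_commute)
    then show ?thesis by (rule isomorphic_coded[OF _ coded_G_ex]) simp
  qed
qed

theorem mainTheorem3:
  shows "(regular_3_edge_colored 8 G_ex
        \<and> two_faces_per_color_pair G_ex
        \<and> all_faces_length_8 G_ex
        \<and> faces_share_two_edges G_ex
        \<and> F_max G_ex = 12)
    \<and> (\<forall>G :: 'a colored_graph.
          regular_3_edge_colored 8 G
        \<and> two_faces_per_color_pair G
        \<and> all_faces_length_8 G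
        \<and> faces_share_two_edges G
        \<and> F_max G = 12
        \<longrightarrow> isomorphic G G_ex)"
  using regular_G_ex two_faces_G_ex length_8_G_ex share_two_G_ex F_max_G_ex isomorphic_G_ex by blast

end
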